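(* Let $a=(a_i)_{i\in\mathbb Z}$ and $b=(b_i)_{i\in\mathbb Z}$ be two sequences of complex parameters. For a Young diagram $\mu$, in the expansion $$s_{\mu;a}=\sum_\nu c_{\mu\nu}(a,b)\,s_{\nu;b}$$ the coefficients $c_{\mu\nu}(a,b)$ vanish unless $\nu\subseteq\mu$ and $d(\nu)=d(\mu)$. Assume $d(\nu)=d(\mu)=d$ and write both diagrams in Frobenius notation, $\mu=(p_1,\dots,p_d\,|\,q_1,\dots,q_d)$, $\nu=(p'_1,\dots,p'_d\,|\,q'_1,\dots,q'_d)$. Then $$c_{\mu\nu}(a,b)=\det[c_{p_i,p'_j}(a,b)]_{i,j=1}^d\;\det[c_{q_i,q'_j}(\widehat a,\widehat b)]_{i,j=1}^d,$$ where for $p\ge p'\ge0$ $$c_{pp'}(a,b)=h_{p-p'}(b_1,\dots,b_{p'+1};-a_1,\dots,-a_p),$$ and $c_{pp'}(a,b)=0$ for $p'>p$.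
   Context: The base field is $\mathbb C$. $\Lambda=\mathbb C[\mathbf p_1,\mathbf p_2,\dots]$ is the algebra of symmetric functions (polynomial ring in the power sums). Its elements $h_k$ are defined by $H(u)=1+\sum_{k\ge1}h_ku^{-k}=\exp\big(\sum_{k\ge1}\mathbf p_ku^{-k}/k\big)\in\Lambda[[u^{-1}]]$, $h_0=1$. The supersymmetric polynomial $h_k(x_1,\dots,x_r;y_1,\dots,y_s)$ is the coefficient of $t^k$ in $\prod_{j=1}^s(1+y_jt)\big/\prod_{i=1}^r(1-x_it)$. The elements $h_{k;a}\in\Lambda$ are defined by $1+\sum_{k\ge1}\frac{h_{k;a}}{(u-a_1)\cdots(u-a_k)}=H(u)$ in $\Lambda[[u^{-1}]]$, with $h_{0;a}=1$, $h_{k;a}=0$ for $k<0$. For $r\in\mathbb Z$, $(\tau^ra)_i=a_{i+r}$. The multiparameter Schur function is $s_{\mu;a}=\det[h_{\mu_i-i+j;\,\tau^{1-j}a}]$ (order any number $\ge\ell(\mu)$). For each fixed sequence $b$ the elements $s_{\nu;b}$ form a basis of $\Lambda$. $\widehat a_i=-a_{-i+1}$ and $\widehat b_i=-b_{-i+1}$. $d(\mu)$ is the number of diagonal squares of $\mu$; Frobenius coordinates: $p_i=\mu_i-i$, $q_i=\mu'_i-i$, $1\le i\le d(\mu)$, $\mu'$ the transposed diagram. *)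

theory Defs
  imports
    "HOL-Computational_Algebra.Formal_Power_Series"
    "HOL-Library.Poly_Mapping"
    "Jordan_Normal_Form.Determinant"
begin

text \<open>
  The polynomial ring over the complex numbers in countably many variables; a monomial is a
  finitely supported exponent function. Variables are numbered from 0, so the power sum
  \<open>p\<^sub>k\<close> (for \<open>k \<ge> 1\<close>) is the variable with number \<open>k - 1\<close>.
\<close>

type_synonym symfun = "(nat \<Rightarrow>\<^sub>0 nat) \<Rightarrow>\<^sub>0 complex"

definition scalar :: "complex \<Rightarrow> symfun" where
  "scalar c = Poly_Mapping.single 0 c"

definition powersum :: "nat \<Rightarrow> symfun" where
  "powersum k = Poly_Mapping.single (Poly_Mapping.single (k - 1) 1) 1"

text \<open>
  Elements of \<open>\<Lambda>[[u\<^sup>-\<^sup>1]]\<close> are formal power series whose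
  variable \<^const>\<open>fps_X\<close> stands for \<open>u\<^sup>-\<^sup>1\<close>. The library's
  exponential series and the division of power series need coefficients in a field, hence
  the exponential series with scalar coefficients and the geometric series below.
\<close>

definition H_series :: "symfun fps" where
  "H_series = Abs_fps (\<lambda>n. scalar (1 / fact n)) oo
     Abs_fps (\<lambda>k. if k = 0 then 0 else scalar (1 / of_nat k) * powersum k)"

definition inv_linear :: "complex \<Rightarrow> symfun fps" where
  "inv_linear c = Abs_fps (\<lambda>n. scalar (c ^ n))"

text \<open>\<open>1 / ((u - a\<^sub>1) \<dots> (u - a\<^sub>k))\<close>, each factor being
  \<open>u\<^sup>-\<^sup>1 / (1 - a\<^sub>i u\<^sup>-\<^sup>1)\<close>.\<close>

definition inv_shifted_power :: "(int \<Rightarrow> complex) \<Rightarrow> nat \<Rightarrow> symfun fps" where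
  "inv_shifted_power a k = (\<Prod>i = 1..k. fps_X * inv_linear (a (int i)))"

definition is_h_family :: "(int \<Rightarrow> complex) \<Rightarrow> (nat \<Rightarrow> symfun) \<Rightarrow> bool" where
  "is_h_family a g \<longleftrightarrow>
     g 0 = 1 \<and> (\<lambda>k. fps_const (g k) * inv_shifted_power a k) sums H_series"

definition h_multi :: "(int \<Rightarrow> complex) \<Rightarrow> int \<Rightarrow> symfun" where
  "h_multi a k = (if k < 0 then 0 else (THE g. is_h_family a g) (nat k))"

text \<open>A diagram is its set of boxes (row, column), both numbered from 1.\<close>

definition young_diagram :: "(nat \<times> nat) set \<Rightarrow> bool" where
  "young_diagram D \<longleftrightarrow> finite D \<and> D \<subseteq> {1..} \<times> {1..} \<and>
     (\<forall>i j i' j'. (i, j) \<in> D \<longrightarrow> 1 \<le> i' \<longrightarrow> i' \<le> i \<longrightarrow> 1 \<le> j' \<longrightarrow> j' \<le> j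
        \<longrightarrow> (i', j') \<in> D)"

definition row_length :: "(nat \<times> nat) set \<Rightarrow> nat \<Rightarrow> nat" where
  "row_length D i = card {j. (i, j) \<in> D}"

definition num_rows :: "(nat \<times> nat) set \<Rightarrow> nat" where
  "num_rows D = card {i. \<exists>j. (i, j) \<in> D}"

definition transposed :: "(nat \<times> nat) set \<Rightarrow> (nat \<times> nat) set" where
  "transposed D = {(j, i) |i j. (i, j) \<in> D}"

definition diag_size :: "(nat \<times> nat) set \<Rightarrow> nat" where
  "diag_size D = card {i. (i, i) \<in> D}"

text \<open>For \<open>1 \<le> i \<le> diag_size D\<close> the subtractions do not truncate.\<close>

definition frob_p :: "(nat \<times> nat) set \<Rightarrow> nat \<Rightarrow> nat" where
  "frob_p D i = row_length D i - i"

definition frob_q :: "(nat \<times> nat) set \<Rightarrow> nat \<Rightarrow> nat" where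
  "frob_q D i = row_length (transposed D) i - i"

definition shift :: "int \<Rightarrow> (int \<Rightarrow> complex) \<Rightarrow> int \<Rightarrow> complex" where
  "shift r a = (\<lambda>i. a (i + r))"

definition hat :: "(int \<Rightarrow> complex) \<Rightarrow> int \<Rightarrow> complex" where
  "hat a = (\<lambda>i. - a (- i + 1))"

text \<open>Matrix indices start from 0, so the \<open>(i, j)\<close> entry of the mathematical
  determinant sits at position \<open>(i - 1, j - 1)\<close>, here and below.\<close>

definition schur_det :: "nat \<Rightarrow> (int \<Rightarrow> complex) \<Rightarrow> (nat \<times> nat) set \<Rightarrow> symfun" where
  "schur_det n a D = det (mat n n (\<lambda>(i, j).
     h_multi (shift (1 - int (Suc j)) a) (int (row_length D (Suc i)) - int (Suc i) + int (Suc j))))"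

definition multi_schur :: "(int \<Rightarrow> complex) \<Rightarrow> (nat \<times> nat) set \<Rightarrow> symfun" where
  "multi_schur a D = schur_det (num_rows D) a D"

definition schur_expansion ::
  "(int \<Rightarrow> complex) \<Rightarrow> (int \<Rightarrow> complex) \<Rightarrow> (nat \<times> nat) set
     \<Rightarrow> ((nat \<times> nat) set \<Rightarrow> complex) \<Rightarrow> bool" where
  "schur_expansion a b D c \<longleftrightarrow>
     finite {E. c E \<noteq> 0} \<and> {E. c E \<noteq> 0} \<subseteq> {E. young_diagram E} \<and>
     multi_schur a D = (\<Sum>E | c E \<noteq> 0. scalar (c E) * multi_schur b E)"

definition transition_coeff ::
  "(int \<Rightarrow> complex) \<Rightarrow> (int \<Rightarrow> complex) \<Rightarrow> (nat \<times> nat) set \<Rightarrow> (nat \<times> nat) set \<Rightarrow> complex"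
  where "transition_coeff a b D = (THE c. schur_expansion a b D c)"

definition super_h :: "nat \<Rightarrow> complex list \<Rightarrow> complex list \<Rightarrow> complex" where
  "super_h k xs ys =
     fps_nth ((\<Prod>y\<leftarrow>ys. 1 + fps_const y * fps_X) / (\<Prod>x\<leftarrow>xs. 1 - fps_const x * fps_X)) k"

definition hook_coeff :: "(int \<Rightarrow> complex) \<Rightarrow> (int \<Rightarrow> complex) \<Rightarrow> nat \<Rightarrow> nat \<Rightarrow> complex" where
  "hook_coeff a b p p' =
     (if p' \<le> p
      then super_h (p - p') (map b [1..int p' + 1]) (map (\<lambda>i. - a i) [1..int p])
      else 0)"

lemma scalar_0 [simp]: "scalar 0 = 0"
  by (simp add: scalar_def)

lemma scalar_1 [simp]: "scalar 1 = 1"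
  by (simp add: scalar_def)

lemma scalar_mult: "scalar (c * d) = scalar c * scalar d"
  by (simp add: scalar_def mult_single)

lemma inv_linear: "(1 - fps_const (scalar c) * fps_X) * inv_linear c = 1"
proof (rule fps_ext)
  fix n
  have "(1 - fps_const (scalar c) * fps_X) * inv_linear c
      = inv_linear c - fps_const (scalar c) * (fps_X * inv_linear c)"
    by (simp add: algebra_simps)
  then show "fps_nth ((1 - fps_const (scalar c) * fps_X) * inv_linear c) n = fps_nth 1 n"
    by (cases n) (simp_all add: inv_linear_def scalar_mult)
qed

lemma inv_shifted_power_Suc:
  "inv_shifted_power a (Suc k) = inv_shifted_power a k * (fps_X * inv_linear (a (int (Suc k))))"
  by (simp add: inv_shifted_power_def)

lemma inv_shifted_power_nth_less: "n < k \<Longrightarrow> fps_nth (inv_shifted_power a k) n = 0"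
proof (induction k arbitrary: n)
  case (Suc k)
  have "inv_shifted_power a (Suc k)
      = fps_X * (inv_shifted_power a k * inv_linear (a (int (Suc k))))"
    by (simp add: inv_shifted_power_Suc mult_ac)
  moreover have "fps_nth (inv_shifted_power a k * inv_linear (a (int (Suc k)))) m = 0" if "m < k" for m
    unfolding fps_mult_nth by (rule sum.neutral) (use Suc.IH that in auto)
  ultimately show ?case
    using Suc.prems by (cases n) auto
qed simp

lemma inv_shifted_power_nth_same [simp]: "fps_nth (inv_shifted_power a k) k = 1"
proof (induction k)
  case 0
  show ?case by (simp add: inv_shifted_power_def)
next
  case (Suc k)
  have "inv_shifted_power a (Suc k)
      = fps_X * (inv_shifted_power a k * inv_linear (a (int (Suc k))))"
    by (simp add: inv_shifted_power_Suc mult_ac)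
  moreover have "fps_nth (inv_shifted_power a k * inv_linear (a (int (Suc k)))) k
      = (\<Sum>i=0..k. if i = k then 1 else 0)"
    unfolding fps_mult_nth
    by (rule sum.cong) (use Suc.IH in \<open>auto simp: inv_shifted_power_nth_less inv_linear_def\<close>)
  ultimately show ?case
    by simp
qed

lemma H_series_nth_0 [simp]: "fps_nth H_series 0 = 1"
  by (simp add: H_series_def)

lemma is_h_family_iff:
  "is_h_family a g \<longleftrightarrow>
     (\<forall>n. (\<Sum>k\<le>n. g k * fps_nth (inv_shifted_power a k) n) = fps_nth H_series n)"
  (is "_ \<longleftrightarrow> (\<forall>n. ?S n = _)")
proof -
  let ?P = "\<lambda>N. \<Sum>k<N. fps_const (g k) * inv_shifted_power a k"
  have nth: "fps_nth (?P N) n = ?S n" if "n < N" for n N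
  proof -
    have "fps_nth (?P N) n = (\<Sum>k<N. g k * fps_nth (inv_shifted_power a k) n)"
      by (simp add: fps_sum_nth)
    also have "\<dots> = ?S n"
      by (rule sum.mono_neutral_right) (use that in \<open>auto simp: inv_shifted_power_nth_less\<close>)
    finally show ?thesis .
  qed
  have "(\<lambda>k. fps_const (g k) * inv_shifted_power a k) sums H_series \<longleftrightarrow>
      (\<forall>n. \<forall>\<^sub>F N in sequentially. fps_nth (?P N) n = fps_nth H_series n)"
    by (simp add: sums_def tendsto_fps_iff)
  also have "\<dots> \<longleftrightarrow> (\<forall>n. ?S n = fps_nth H_series n)"
  proof (intro arg_cong[where f = All] ext)
    fix n
    have "(\<forall>\<^sub>F N in sequentially. fps_nth (?P N) n = fps_nth H_series n) \<longleftrightarrow>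
        (\<forall>\<^sub>F N in sequentially. ?S n = fps_nth H_series n)"
      by (rule eventually_cong[OF eventually_gt_at_top[of n]]) (simp add: nth)
    then show "(\<forall>\<^sub>F N in sequentially. fps_nth (?P N) n = fps_nth H_series n) \<longleftrightarrow>
        ?S n = fps_nth H_series n"
      by simp
  qed
  finally have *: "(\<lambda>k. fps_const (g k) * inv_shifted_power a k) sums H_series \<longleftrightarrow>
      (\<forall>n. ?S n = fps_nth H_series n)" .
  moreover have "g 0 = 1" if "\<forall>n. ?S n = fps_nth H_series n"
    using that[rule_format, of 0] by simp
  ultimately show ?thesis
    unfolding is_h_family_def by blast
qed

lemma is_h_family_iff_rec:
  "is_h_family a g \<longleftrightarrow>
     (\<forall>n. g n = fps_nth H_series n - (\<Sum>k<n. g k * fps_nth (inv_shifted_power a k) n))"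
  unfolding is_h_family_iff lessThan_Suc_atMost[symmetric]
  by (simp add: algebra_simps)

lemma ex1_h_family: "\<exists>!g. is_h_family a g"
proof (rule ex_ex1I)
  let ?R = "\<lambda>g n. fps_nth H_series n - (\<Sum>k<n. g k * fps_nth (inv_shifted_power a k) n)"
  have cong: "?R g n = ?R g' n" if "\<And>k. k < n \<Longrightarrow> g k = g' k" for g g' :: "nat \<Rightarrow> symfun" and n
    by (intro arg_cong2[where f = minus] sum.cong refl) (simp add: that)
  have "\<exists>g. \<forall>n. g n = ?R g n"
  proof (rule dependent_wellorder_choice[where P = "\<lambda>g n r. r = ?R g n"])
    fix r :: symfun and g g' :: "nat \<Rightarrow> symfun" and n
    assume "\<And>k. k < n \<Longrightarrow> g k = g' k"
    then show "(r = ?R g n) = (r = ?R g' n)"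
      by (simp only: cong[of n g g'])
  qed (rule exI, rule refl)
  then show "\<exists>g. is_h_family a g"
    unfolding is_h_family_iff_rec .
  fix g g'
  assume "is_h_family a g" "is_h_family a g'"
  then have eq: "g n = ?R g n" "g' n = ?R g' n" for n
    unfolding is_h_family_iff_rec by blast+
  have "g n = g' n" for n
  proof (induction n rule: less_induct)
    case (less n)
    have "g n = ?R g n" by (rule eq)
    also have "\<dots> = ?R g' n" by (rule cong) (rule less)
    also have "\<dots> = g' n" by (rule eq(2)[symmetric])
    finally show ?case .
  qed
  then show "g = g'" ..
qed

lemma is_h_family_h_multi: "is_h_family a (\<lambda>k. h_multi a (int k))"
  using theI'[OF ex1_h_family[of a]] by (simp add: h_multi_def)

lemma h_multi_0 [simp]: "h_multi a 0 = 1"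
  using is_h_family_h_multi[of a] by (simp add: is_h_family_def)

lemma num_rows_less_row_length_0:
  assumes D: "young_diagram D" and i: "num_rows D < i"
  shows "row_length D i = 0"
proof (rule ccontr)
  assume "row_length D i \<noteq> 0"
  then obtain j where j: "(i, j) \<in> D"
    unfolding row_length_def by (metis card.empty empty_Collect_eq)
  have "1 \<le> j"
    using D j by (auto simp: young_diagram_def)
  then have "(i', j) \<in> D" if "i' \<in> {1..i}" for i'
    using D j that unfolding young_diagram_def by (metis atLeastAtMost_iff order_refl)
  then have "{1..i} \<subseteq> {i. \<exists>j. (i, j) \<in> D}"
    by blast
  moreover have "finite {i. \<exists>j. (i, j) \<in> D}"
  proof (rule finite_subset)
    show "{i. \<exists>j. (i, j) \<in> D} \<subseteq> fst ` D" by force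
  qed (use D in \<open>simp add: young_diagram_def\<close>)
  ultimately have "card {1..i} \<le> num_rows D"
    unfolding num_rows_def by (rule card_mono[rotated])
  with i show False by simp
qed

text \<open>The determinant may be taken of any order not smaller than the number of rows.\<close>

lemma schur_det_eq_multi_schur:
  assumes "young_diagram D" and "num_rows D \<le> n"
  shows "schur_det n a D = multi_schur a D"
  using assms(2)
proof (induction n rule: dec_induct)
  case base
  show ?case by (simp add: multi_schur_def)
next
  case (step n)
  define f where "f = (\<lambda>(i, j). h_multi (shift (1 - int (Suc j)) a)
    (int (row_length D (Suc i)) - int (Suc i) + int (Suc j)))"
  have last_row: "f (n, j) = (if j = n then 1 else 0)" if "j \<le> n" for j
  proof -
    have "f (n, j) = h_multi (shift (1 - int (Suc j)) a) (int j - int n)"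
      using num_rows_less_row_length_0[OF assms(1), of "Suc n"] step.hyps by (simp add: f_def)
    then show ?thesis
      using that by (cases "j = n") (simp_all add: h_multi_def[of _ "int j - int n"])
  qed
  have "det (mat (Suc n) (Suc n) f)
      = (\<Sum>j<Suc n. f (n, j) * cofactor (mat (Suc n) (Suc n) f) n j)"
    by (subst laplace_expansion_row[of _ "Suc n" n]) auto
  also have "\<dots> = cofactor (mat (Suc n) (Suc n) f) n n"
    by (simp add: last_row)
  also have "mat_delete (mat (Suc n) (Suc n) f) n n = mat n n f"
    by (rule eq_matI) (auto simp: mat_delete_def)
  then have "cofactor (mat (Suc n) (Suc n) f) n n = det (mat n n f)"
    by (simp add: cofactor_def)
  finally show ?case
    using step.IH by (simp add: schur_det_def f_def)
qed

end

theory Submission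
  imports Defs "HOL-Computational_Algebra.Formal_Laurent_Series"
begin

text \<open>
  The coefficients factor because a change of parameters is a change of basis for Laurent series in
  \<open>1/u\<close>, under which the rows of the Jacobi--Trudi matrix with \<open>\<mu>\<^sub>i - i \<ge> 0\<close> and those with
  \<open>\<mu>\<^sub>i - i < 0\<close> transform separately.

  Let \<open>\<Phi>\<^sub>n = (u - a\<^sub>1) \<dots> (u - a\<^sub>n)\<close>, continued to all integers \<open>n\<close> by
  \<open>\<Phi>\<^sub>n / \<Phi>\<^sub>n\<^sub>-\<^sub>1 = u - a\<^sub>n\<close>. The functional that sends \<open>F\<close> to the coefficient
  of \<open>1/u\<close> in \<open>F(u) H(u)\<close> sends \<open>\<Phi>\<^sub>n / \<Phi>\<^sub>-\<^sub>j\<close> to the Jacobi--Trudi entry in column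
  \<open>j + 1\<close> and a row with \<open>\<mu>\<^sub>i - i = n\<close> (\<open>h_multi_shift\<close>). So the row depends on \<open>\<Phi>\<^sub>n\<close>
  only and the column on \<open>1 / \<Phi>\<^sub>-\<^sub>j\<close> only. The polynomials \<open>\<Phi>\<^sub>p\<close> for \<open>a\<close> expand in those
  for \<open>b\<close> by Newton interpolation, and the coefficients, being residues, are the
  \<open>c\<^sub>p\<^sub>p'(a,b)\<close>. The negative powers expand among themselves, and the reflection
  \<open>a\<^sub>i \<mapsto> a\<^sub>1\<^sub>-\<^sub>i\<close>, which exchanges \<open>\<Phi>\<^sub>n\<close> with \<open>1 / \<Phi>\<^sub>-\<^sub>n\<close>, turns their
  coefficients into \<open>c\<^sub>q\<^sub>q'\<close> for the hatted sequences, up to sign.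

  Column operations turn the rows with negative \<open>n\<close> into an identity matrix. What is left in
  the row \<open>p \<ge> 0\<close> and column \<open>q\<close> is, up to the sign \<open>(-1)\<^sup>q\<close>, the function of the hook
  \<open>(p | q)\<close>, and expanding along the unit rows gives the Giambelli formula (\<open>giambelli\<close>). In
  this normal form the change of basis is a product of three matrices
  (\<open>hook_fun_transition\<close>), so that the Cauchy--Binet formula, used once for the rows and once
  for the columns, yields a sum over pairs of sets of Frobenius coordinates, that is over
  diagrams with the same number of diagonal squares (\<open>schur_expansion_frob_coeff\<close>).

  The coefficients are only determined if the functions for \<open>b\<close> are linearly independent. For
  \<open>b\<^sub>i = i\<close>, specialising \<open>H(u)\<close> to a rational function attached to a diagram \<open>\<lambda>\<close> kills the
  functions of all diagrams with at most a given number of rows that are not contained in \<open>\<lambda>\<close>,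
  but not that of \<open>\<lambda>\<close>
  (\<open>vanishing_specialisation\<close>). Since the expansion just obtained is unitriangular for
  inclusion, independence carries over to every \<open>b\<close>.
\<close>

section \<open>Laurent series in the inverse of u\<close>

text \<open>
  Throughout, the variable \<^const>\<open>fls_X\<close> stands for \<open>1/u\<close>, so that \<^const>\<open>fls_X_inv\<close> is
  \<open>u\<close> and the coefficient of \<open>1/u\<close> has index \<open>1\<close>.
\<close>

definition factor :: "complex \<Rightarrow> complex fls" where
  "factor c = fls_X_inv - fls_const c"

text \<open>
  The generalised power \<open>(u|a)\<^sup>n\<close> for all integers \<open>n\<close>; at least one of the two products is
  always empty. The value for negative \<open>n\<close> is the one that makes the quotient of consecutive powers
  \<open>u - a\<^sub>n\<close> throughout.
\<close>

definition gen_power :: "(int \<Rightarrow> complex) \<Rightarrow> int \<Rightarrow> complex fls" where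
  "gen_power a n = (\<Prod>i\<in>{1..n}. factor (a i)) / (\<Prod>i\<in>{n + 1..0}. factor (a i))"

abbreviation res :: "complex fls \<Rightarrow> complex" where
  "res F \<equiv> fls_nth F 1"

text \<open>The degree is that in \<open>u\<close>, hence the reversed inequality for indices.\<close>

definition deg_le :: "complex fls \<Rightarrow> int \<Rightarrow> bool" where
  "deg_le F n \<longleftrightarrow> (\<forall>i < - n. fls_nth F i = 0)"

definition poly_in_u :: "complex fls \<Rightarrow> bool" where
  "poly_in_u F \<longleftrightarrow> (\<forall>i > 0. fls_nth F i = 0)"

lemma factor_nth:
  "fls_nth (factor c) i = (if i = -1 then 1 else if i = 0 then - c else 0)"
  by (auto simp: factor_def)

lemma factor_nonzero [simp]: "factor c \<noteq> 0"
proof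
  assume "factor c = 0"
  then have "fls_nth (factor c) (-1) = 0" by (metis fls_zero_nth)
  then show False by (simp add: factor_nth)
qed

lemma factor_subdegree: "fls_subdegree (factor c) = -1"
  by (rule fls_subdegree_eqI) (auto simp: factor_nth)

lemma factor_mult_nth: "fls_nth (factor c * F) i = fls_nth F (i + 1) - c * fls_nth F i"
  by (simp add: factor_def left_diff_distrib fls_X_inv_times_conv_shift)

lemma gen_power_0 [simp]: "gen_power a 0 = 1"
  by (simp add: gen_power_def)

lemma gen_power_nonzero [simp]: "gen_power a n \<noteq> 0"
  by (simp add: gen_power_def)

lemma gen_power_step: "gen_power a n = gen_power a (n - 1) * factor (a n)"
proof (cases "n \<ge> 1")
  case True
  have "{1..n} = insert n {1..n - 1}" using True by auto
  then show ?thesis using True by (simp add: gen_power_def mult_ac)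
next
  case False
  have "{n..0} = insert n {n + 1..0}" using False by auto
  moreover have "{1..n} = {}" "{1..n - 1} = {}" using False by auto
  ultimately show ?thesis by (simp add: gen_power_def add.commute)
qed

lemma gen_power_quotient:
  assumes "m \<le> n"
  shows "gen_power a n = gen_power a m * (\<Prod>i\<in>{m + 1..n}. factor (a i))"
  using assms
proof (induction n rule: int_ge_induct)
  case base
  show ?case by simp
next
  case (step n)
  have "{m + 1..n + 1} = insert (n + 1) {m + 1..n}" using step by auto
  then show ?case using step gen_power_step[of a "n + 1"] by (simp add: mult_ac)
qed

text \<open>
  Reflecting the parameters exchanges numerators and denominators, so every fact about
  non-negative powers has a counterpart for negative ones. This is where the hatted
  sequences of the second determinant come from; they are the reflected ones up to sign.
\<close>

lemma gen_power_reflect: "gen_power (\<lambda>i. a (1 - i)) n = 1 / gen_power a (- n)"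
proof -
  have 1: "(\<Prod>i\<in>{1..n}. factor (a (1 - i))) = (\<Prod>i\<in>{- n + 1..0}. factor (a i))"
    by (rule prod.reindex_bij_witness[of _ "\<lambda>i. 1 - i" "\<lambda>i. 1 - i"]) auto
  have 2: "(\<Prod>i\<in>{n + 1..0}. factor (a (1 - i))) = (\<Prod>i\<in>{1..- n}. factor (a i))"
    by (rule prod.reindex_bij_witness[of _ "\<lambda>i. 1 - i" "\<lambda>i. 1 - i"]) auto
  show ?thesis by (simp add: gen_power_def 1 2)
qed

lemma gen_power_subdegree: "fls_subdegree (gen_power a n) = - n"
proof -
  have "fls_subdegree (\<Prod>i\<in>S. factor (a i)) = - int (card S)" if "finite S" for S
    using that by (induction S) (auto simp: factor_subdegree)
  then show ?thesis
    by (simp add: gen_power_def fls_divide_subdegree)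
qed

lemma fls_subdegree_prod:
  fixes f :: "'b \<Rightarrow> complex fls"
  shows "(\<And>i. i \<in> S \<Longrightarrow> f i \<noteq> 0) \<Longrightarrow> fls_subdegree (\<Prod>i\<in>S. f i) = (\<Sum>i\<in>S. fls_subdegree (f i))"
  by (induction S rule: infinite_finite_induct) auto

lemma deg_le_iff: "deg_le F n \<longleftrightarrow> F = 0 \<or> - n \<le> fls_subdegree F"
  unfolding deg_le_def
  by (metis fls_eq0_below_subdegree fls_subdegree_geI fls_zero_nth not_le order_less_le_trans)

lemma deg_le_mult:
  assumes "deg_le F m" "deg_le G n"
  shows "deg_le (F * G) (m + n)"
  using assms fls_mult_subdegree_ge[of F G] unfolding deg_le_iff by (cases "F * G = 0") auto

lemma top_coeff_mult:
  assumes "deg_le F m" "deg_le G n"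
  shows "fls_nth (F * G) (- m - n) = fls_nth F (- m) * fls_nth G (- n)"
proof (cases "F = 0 \<or> G = 0")
  case False
  then have s: "- m \<le> fls_subdegree F" "- n \<le> fls_subdegree G"
    using assms by (auto simp: deg_le_iff)
  show ?thesis
  proof (cases "- m = fls_subdegree F \<and> - n = fls_subdegree G")
    case True
    then have "- m - n = fls_subdegree F + fls_subdegree G" by simp
    then show ?thesis using fls_times_base[of F G] True by (simp only:)
  next
    case 2: False
    then have "- m < fls_subdegree F \<or> - n < fls_subdegree G" using s by auto
    then have "fls_nth F (- m) * fls_nth G (- n) = 0" by auto
    moreover have "fls_nth (F * G) (- m - n) = 0"
      by (rule fls_times_nth_eq0) (use 2 s in auto)
    ultimately show ?thesis by simp
  qed
qed auto

lemma deg_le_gen_power: "deg_le (gen_power a n) n"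
  by (simp add: deg_le_iff gen_power_subdegree)

lemma prod_factor_top:
  assumes "finite S"
  shows "deg_le (\<Prod>i\<in>S. factor (f i)) (int (card S))"
    and "fls_nth (\<Prod>i\<in>S. factor (f i)) (- int (card S)) = 1"
proof -
  show *: "deg_le (\<Prod>i\<in>S. factor (f i)) (int (card S))" for S
    by (simp add: deg_le_iff fls_subdegree_prod factor_subdegree)
  show "fls_nth (\<Prod>i\<in>S. factor (f i)) (- int (card S)) = 1"
    using assms
  proof (induction S)
    case (insert x S)
    have "deg_le (factor (f x)) 1" by (simp add: deg_le_iff factor_subdegree)
    from top_coeff_mult[OF this *[of S]] show ?case
      using insert by (simp add: factor_nth algebra_simps)
  qed simp
qed

lemma gen_power_top: "fls_nth (gen_power a n) (- n) = 1"
proof (cases "n \<ge> 0")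
  case True
  then show ?thesis
    using prod_factor_top(2)[of "{1..n}" a] by (simp add: gen_power_def)
next
  case False
  have *: "gen_power a n * (\<Prod>i\<in>{n + 1..0}. factor (a i)) = 1"
    using gen_power_quotient[of n 0 a] False by simp
  have "fls_nth (gen_power a n * (\<Prod>i\<in>{n + 1..0}. factor (a i))) (- n - (- n)) = 
     fls_nth (gen_power a n) (- n) * fls_nth (\<Prod>i\<in>{n + 1..0}. factor (a i)) (- (- n))"
    by (rule top_coeff_mult) (use prod_factor_top(1)[of "{n + 1..0}" a] False in
      \<open>auto simp: deg_le_gen_power\<close>)
  then show ?thesis
    using prod_factor_top(2)[of "{n + 1..0}" a] False by (simp add: *)
qed

lemma gen_power_divide_deg: "deg_le (gen_power a n / gen_power b m) (n - m)"
  by (simp add: deg_le_iff gen_power_subdegree fls_divide_subdegree)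

lemma poly_in_u_prod_mult: "finite S \<Longrightarrow> poly_in_u F \<Longrightarrow> poly_in_u ((\<Prod>i\<in>S. factor (f i)) * F)"
  by (induction S rule: finite_induct) (auto simp: poly_in_u_def factor_mult_nth mult.assoc)

lemma poly_in_u_prod: "finite S \<Longrightarrow> poly_in_u (\<Prod>i\<in>S. factor (f i))"
  using poly_in_u_prod_mult[of S 1 f] by (simp add: poly_in_u_def)

lemma poly_in_u_gen_power_quotient: "m \<le> n \<Longrightarrow> poly_in_u (gen_power a n / gen_power a m)"
  using gen_power_quotient[of m n a] by (simp add: poly_in_u_prod)

lemma res_poly_in_u: "poly_in_u F \<Longrightarrow> res F = 0"
  by (simp add: poly_in_u_def)

text \<open>
  Newton interpolation, extended to negative powers. The coefficients are residues since
  \<open>(u|a)\<^sup>k / (u|a)\<^sup>l\<^sup>+\<^sup>1\<close> has residue \<open>1\<close> for \<open>k = l\<close>, is a polynomial for \<open>k > l\<close>, and is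
  of degree less than \<open>-1\<close> for \<open>k < l\<close>. Subtracting the top term lowers the degree
  by one and leaves the lower coefficients unchanged.
\<close>

lemma newton_expansion:
  assumes "deg_le F n"
  shows "deg_le (F - (\<Sum>k\<in>{m..n}. fls_const (res (F / gen_power a (k + 1))) * gen_power a k)) (m - 1)"
proof (cases "m \<le> n + 1")
  case False
  then show ?thesis using assms by (auto simp: deg_le_def)
next
  case True
  then have "m - 1 \<le> n" by simp
  then show ?thesis using assms
  proof (induction n arbitrary: F rule: int_ge_induct)
    case base
    then show ?case by simp
  next
    case (step n F)
    define c where "c = res (F / gen_power a (n + 2))"
    define F' where "F' = F - fls_const c * gen_power a (n + 1)"
    have "fls_nth (F * (1 / gen_power a (n + 2))) (- (n + 1) - (- n - 2)) =
        fls_nth F (- (n + 1)) * fls_nth (1 / gen_power a (n + 2)) (- (- n - 2))"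
      by (rule top_coeff_mult)
        (use step.prems gen_power_divide_deg[of a 0 a "n + 2"] in simp_all)
    moreover have "fls_nth (1 / gen_power a (n + 2)) (n + 2) = 1"
      using gen_power_top[of "\<lambda>i. a (1 - i)" "- (n + 2)"] by (simp add: gen_power_reflect add.commute)
    ultimately have c: "c = fls_nth F (- (n + 1))"
      by (simp add: c_def add.commute)
    have "fls_nth F' i = 0" if "i < - n" for i
    proof (cases "i = - (n + 1)")
      case True
      then show ?thesis using gen_power_top[of a "n + 1"] by (simp add: F'_def c)
    next
      case False
      then show ?thesis using step.prems deg_le_gen_power[of a "n + 1"] that
        by (auto simp: F'_def deg_le_def)
    qed
    then have F': "deg_le F' n" by (simp add: deg_le_def)
    have "res (F' / gen_power a (k + 1)) = res (F / gen_power a (k + 1))" if "k \<le> n" for k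
    proof -
      have "res (gen_power a (n + 1) / gen_power a (k + 1)) = 0"
        by (rule res_poly_in_u, rule poly_in_u_gen_power_quotient) (use that in simp)
      then have "res (fls_const c * (gen_power a (n + 1) / gen_power a (k + 1))) = 0"
        by (simp only: fls_mult_const_nth mult_zero_right)
      then show ?thesis
        by (simp only: F'_def diff_divide_distrib times_divide_eq_right[symmetric] fls_minus_nth diff_zero)
    qed
    moreover have "{m..n + 1} = insert (n + 1) {m..n}" using step.hyps by auto
    ultimately have "F - (\<Sum>k\<in>{m..n + 1}. fls_const (res (F / gen_power a (k + 1))) * gen_power a k)
        = F' - (\<Sum>k\<in>{m..n}. fls_const (res (F' / gen_power a (k + 1))) * gen_power a k)"
      by (simp add: F'_def c_def algebra_simps)
    then show ?case using step.IH[OF F'] by simp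
  qed
qed

section \<open>Complete functions as residues\<close>

text \<open>
  The coefficient of \<open>1/u\<close> in \<open>F(u) H(u)\<close>, as a finite sum over the coefficients of \<open>F\<close>.
  Computing in the field of complex Laurent series and applying this functional avoids Laurent
  series over the ring of symmetric functions, which is not a field.
\<close>

definition H_residue :: "complex fls \<Rightarrow> symfun" where
  "H_residue F = (\<Sum>k | fls_nth F (1 - int k) \<noteq> 0. scalar (fls_nth F (1 - int k)) * fps_nth H_series k)"

lemma scalar_add: "scalar (c + d) = scalar c + scalar d"
  by (simp add: scalar_def single_add)

interpretation scalar: comm_ring_hom scalar
  by unfold_locales (simp_all add: scalar_mult scalar_add)

lemma H_residue_upto:
  assumes "deg_le F (int N - 1)"
  shows "H_residue F = (\<Sum>k\<le>N. scalar (fls_nth F (1 - int k)) * fps_nth H_series k)"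
  unfolding H_residue_def
proof (rule sum.mono_neutral_left)
  show "{k. fls_nth F (1 - int k) \<noteq> 0} \<subseteq> {..N}"
    using assms by (force simp: deg_le_def)
qed auto

lemma ex_deg_le: "\<exists>M. \<forall>N\<ge>M. deg_le F (int N - 1)"
  by (rule exI[of _ "nat (1 - fls_subdegree F)"]) (auto simp: deg_le_iff)

lemma H_residue_add: "H_residue (F + G) = H_residue F + H_residue G"
proof -
  obtain M M' where "\<forall>N\<ge>M. deg_le F (int N - 1)" "\<forall>N\<ge>M'. deg_le G (int N - 1)"
    using ex_deg_le by metis
  then have *: "deg_le F (int (max M M') - 1)" "deg_le G (int (max M M') - 1)"
    by simp_all
  then have "deg_le (F + G) (int (max M M') - 1)" by (simp add: deg_le_def)
  then show ?thesis
    by (simp only: H_residue_upto *[THEN H_residue_upto] fls_plus_nth scalar_add distrib_right sum.distrib)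
qed

lemma H_residue_smult: "H_residue (fls_const c * F) = scalar c * H_residue F"
proof -
  obtain N where *: "deg_le F (int N - 1)" using ex_deg_le by blast
  then have "deg_le (fls_const c * F) (int N - 1)" by (simp add: deg_le_def)
  then show ?thesis
    by (simp only: H_residue_upto *[THEN H_residue_upto] fls_mult_const_nth scalar_mult sum_distrib_left mult.assoc)
qed

lemma H_residue_0 [simp]: "H_residue 0 = 0"
  by (simp add: H_residue_def)

lemma H_residue_sum: "H_residue (\<Sum>x\<in>S. F x) = (\<Sum>x\<in>S. H_residue (F x))"
  by (induction S rule: infinite_finite_induct) (simp_all add: H_residue_add)

text \<open>This is why Newton expansions may be cut off below degree \<open>-1\<close>.\<close>

lemma H_residue_low: "deg_le F (-2) \<Longrightarrow> H_residue F = 0"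
  by (simp add: H_residue_def deg_le_def)

lemma H_residue_cong:
  assumes "deg_le (F - G) (-2)"
  shows "H_residue F = H_residue G"
  using H_residue_add[of "F - G" G] H_residue_low[OF assms] by simp

lemma H_residue_gen_power_quotient_low: "n < m - 1 \<Longrightarrow> H_residue (gen_power a n / gen_power b m) = 0"
  using gen_power_divide_deg[of a n b m] by (intro H_residue_low) (auto simp: deg_le_def)

lemma H_residue_gen_power_quotient_pred: "H_residue (gen_power a (m - 1) / gen_power a m) = 1"
proof -
  have 1: "gen_power a (m - 1) / gen_power a m = inverse (factor (a m))"
    using gen_power_step[of a m] by (simp add: field_simps)
  have 2: "deg_le (inverse (factor (a m))) (-1)"
    using gen_power_divide_deg[of a "m - 1" a m] by (simp add: 1)
  have "deg_le (factor (a m)) 1" by (simp add: deg_le_iff factor_subdegree)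
  from top_coeff_mult[OF 2 this] have "fls_nth (inverse (factor (a m))) 1 = 1"
    by (simp add: factor_nth)
  then show ?thesis using H_residue_upto[of "inverse (factor (a m))" 0] 2 by (simp add: 1)
qed

text \<open>
  Both sides satisfy the recursion that multiplication by \<open>u - a\<^sub>k\<^sub>+\<^sub>1\<close> imposes on the coefficients
  of the inverse powers.
\<close>

lemma inv_shifted_power_nth:
  "fps_nth (inv_shifted_power a k) n = scalar (fls_nth (1 / gen_power a (int k)) (int n))"
proof (induction k arbitrary: n)
  case 0
  show ?case by (simp add: inv_shifted_power_def)
next
  case (Suc k)
  let ?c = "a (int (Suc k))"
  have "(1 - fps_const (scalar ?c) * fps_X) * inv_shifted_power a (Suc k)
      = inv_shifted_power a k * fps_X * ((1 - fps_const (scalar ?c) * fps_X) * inv_linear ?c)"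
    by (simp add: inv_shifted_power_Suc mult_ac)
  also have "\<dots> = inv_shifted_power a k * fps_X"
    by (simp only: inv_linear mult_1_right)
  finally have F: "inv_shifted_power a (Suc k)
      = fps_const (scalar ?c) * (fps_X * inv_shifted_power a (Suc k)) + fps_X * inv_shifted_power a k"
    by (simp add: algebra_simps)
  have "factor ?c * (1 / gen_power a (int (Suc k))) = 1 / gen_power a (int k)"
    using gen_power_step[of a "int (Suc k)"] by (simp add: field_simps)
  then have G: "fls_nth (1 / gen_power a (int (Suc k))) (i + 1) - ?c * fls_nth (1 / gen_power a (int (Suc k))) i
      = fls_nth (1 / gen_power a (int k)) i" for i
    by (metis factor_mult_nth)
  show ?case
  proof (induction n)
    case 0
    have "fls_nth (1 / gen_power a (int (Suc k))) 0 = 0"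
      using gen_power_divide_deg[of a 0 a "int (Suc k)"] by (simp add: deg_le_def)
    then show ?case by (simp add: inv_shifted_power_nth_less)
  next
    case (Suc n)
    have "fps_nth (inv_shifted_power a (Suc k)) (Suc n)
        = scalar ?c * fps_nth (inv_shifted_power a (Suc k)) n + fps_nth (inv_shifted_power a k) n"
      by (subst F) simp
    also have "\<dots> = scalar (?c * fls_nth (1 / gen_power a (int (Suc k))) (int n)
         + fls_nth (1 / gen_power a (int k)) (int n))"
      by (simp only: Suc \<open>\<And>n. fps_nth (inv_shifted_power a k) n = _\<close> scalar_mult scalar_add)
    also have "?c * fls_nth (1 / gen_power a (int (Suc k))) (int n)
         + fls_nth (1 / gen_power a (int k)) (int n) = fls_nth (1 / gen_power a (int (Suc k))) (int (Suc n))"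
      using G[of "int n"] by (simp add: algebra_simps)
    finally show ?case .
  qed
qed

lemma H_residue_X_intpow: "H_residue (fls_X_intpow (1 - int n)) = fps_nth H_series n"
proof -
  have "deg_le (fls_X_intpow (1 - int n)) (int n - 1)"
    by (auto simp: deg_le_def)
  then have "H_residue (fls_X_intpow (1 - int n))
     = (\<Sum>k\<le>n. scalar (fls_nth (fls_X_intpow (1 - int n)) (1 - int k)) * fps_nth H_series k)"
    by (rule H_residue_upto)
  also have "\<dots> = (\<Sum>k\<le>n. if k = n then fps_nth H_series k else 0)"
    by (rule sum.cong) auto
  finally show ?thesis by simp
qed

text \<open>
  The coefficient of \<open>u\<^sup>-\<^sup>n\<close> in \<open>H(u)\<close> is the residue of \<open>u\<^sup>n\<^sup>-\<^sup>1 H(u)\<close>, and the Newton coefficients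
  of \<open>u\<^sup>n\<^sup>-\<^sup>1\<close> are the coefficients of \<open>u\<^sup>-\<^sup>n\<close> in the inverse powers. So Newton interpolation is
  the defining equation of the family. Starting the interpolation at the power \<open>-1\<close> covers
  \<open>n = 0\<close> as well.
\<close>

lemma is_h_family_H_residue: "is_h_family a (\<lambda>k. H_residue (gen_power a (int k - 1)))"
  unfolding is_h_family_iff
proof
  fix n
  let ?F = "fls_X_intpow (1 - int n) :: complex fls"
  have deg: "deg_le ?F (int n - 1)"
    by (auto simp: deg_le_def)
  have coeff: "res (?F / gen_power a (k + 1)) = fls_nth (1 / gen_power a (k + 1)) (int n)" for k
  proof -
    have "?F / gen_power a (k + 1) = ?F * (1 / gen_power a (k + 1))" by simp
    then show ?thesis by (simp only: fls_X_intpow_times_conv_shift) simp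
  qed
  have "fps_nth H_series n = H_residue ?F" by (rule H_residue_X_intpow[symmetric])
  also have "\<dots> = H_residue (\<Sum>k\<in>{-1..int n - 1}. fls_const (res (?F / gen_power a (k + 1))) * gen_power a k)"
    using newton_expansion[OF deg, where m = "-1" and a = a] by (intro H_residue_cong) simp
  also have "\<dots> = (\<Sum>k\<in>{-1..int n - 1}. scalar (fls_nth (1 / gen_power a (k + 1)) (int n)) * H_residue (gen_power a k))"
    by (simp only: H_residue_sum H_residue_smult coeff)
  also have "\<dots> = (\<Sum>k\<le>n. scalar (fls_nth (1 / gen_power a (int k)) (int n)) * H_residue (gen_power a (int k - 1)))"
    by (rule sum.reindex_bij_witness[of _ "\<lambda>k. int k - 1" "\<lambda>k. nat (k + 1)"]) auto
  finally show "(\<Sum>k\<le>n. H_residue (gen_power a (int k - 1)) * fps_nth (inv_shifted_power a k) n) = fps_nth H_series n"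
    by (simp add: inv_shifted_power_nth mult.commute)
qed

lemma gen_power_shift: "gen_power (shift r a) n = gen_power a (n + r) / gen_power a r"
proof (induction n rule: int_induct[of _ 0])
  case base
  show ?case by simp
next
  case (step1 n)
  then show ?case
    using gen_power_step[of "shift r a" "n + 1"] gen_power_step[of a "n + 1 + r"]
    by (simp add: shift_def algebra_simps)
next
  case (step2 n)
  then show ?case
    using gen_power_step[of "shift r a" n] gen_power_step[of a "n + r"]
    by (simp add: shift_def field_simps)
qed

text \<open>
  The formula is uniform in \<open>k\<close>: for \<open>k < 0\<close> the quotient has degree less than \<open>-1\<close>, and for
  \<open>k = 0\<close> it is \<open>1 / (u - a\<^sub>r)\<close>, whose residue against \<open>H(u)\<close> is \<open>1\<close>.
\<close>

lemma h_multi_shift: "h_multi (shift r a) k = H_residue (gen_power a (k - 1 + r) / gen_power a r)"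
proof (cases "k < 0")
  case True
  then show ?thesis
    using H_residue_gen_power_quotient_low[of "k - 1 + r" r a a] by (simp add: h_multi_def)
next
  case False
  have "is_h_family (shift r a) (THE g. is_h_family (shift r a) g)"
    by (rule theI'[OF ex1_h_family])
  then have "(THE g. is_h_family (shift r a) g) = (\<lambda>k. H_residue (gen_power (shift r a) (int k - 1)))"
    using is_h_family_H_residue ex1_h_family by blast
  then show ?thesis using False by (simp add: h_multi_def gen_power_shift)
qed

section \<open>The hook coefficients as residues\<close>

lemma prod_factor_fps:
  "(\<Prod>i\<in>{1..int n}. factor (a i)) =
     fls_X_intpow (- int n) * fps_to_fls (\<Prod>i\<in>{1..int n}. 1 - fps_const (a i) * fps_X)"
proof (induction n)
  case (Suc n)
  let ?X = "\<lambda>i. fls_X_intpow i :: complex fls"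
  let ?f = "\<lambda>i. 1 - fps_const (a i) * fps_X"
  have ins: "{1..int (Suc n)} = insert (int (Suc n)) {1..int n}" by auto
  have linear: "factor c = ?X (-1) * fps_to_fls (1 - fps_const c * fps_X)" for c
    unfolding fls_X_intpow_times_conv_shift by (rule fls_eqI) (auto simp: factor_nth)
  have "(\<Prod>i\<in>{1..int (Suc n)}. factor (a i)) = factor (a (int (Suc n))) * (\<Prod>i\<in>{1..int n}. factor (a i))"
    by (subst ins) simp
  also have "\<dots> = (?X (-1) * fps_to_fls (?f (int (Suc n)))) * (?X (- int n) * fps_to_fls (\<Prod>i\<in>{1..int n}. ?f i))"
    by (simp only: linear[of "a (int (Suc n))"] Suc)
  also have "\<dots> = (?X (-1) * ?X (- int n)) * fps_to_fls (?f (int (Suc n)) * (\<Prod>i\<in>{1..int n}. ?f i))"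
    by (simp only: mult_ac fls_times_fps_to_fls)
  also have "?X (-1) * ?X (- int n) = ?X (- int (Suc n))"
    by (simp only: fls_X_intpow_times_fls_X_intpow) simp
  also have "?f (int (Suc n)) * (\<Prod>i\<in>{1..int n}. ?f i) = (\<Prod>i\<in>{1..int (Suc n)}. ?f i)"
    by (subst ins) simp
  finally show ?case .
qed simp

lemma fls_X_intpow_nonzero: "(fls_X_intpow i :: complex fls) \<noteq> 0"
proof
  assume "(fls_X_intpow i :: complex fls) = 0"
  then have "fls_nth (fls_X_intpow i :: complex fls) i = 0" by (simp only: fls_zero_nth)
  then show False by simp
qed

text \<open>
  The generating series of the supersymmetric polynomials with these variables is, after the
  substitution of \<open>1/u\<close>, the quotient of the two powers up to a power of \<open>u\<close>. In this form the
  hook coefficients are Newton coefficients.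
\<close>

lemma hook_coeff_eq_res:
  "hook_coeff a b p p' = res (gen_power a (int p) / gen_power b (int p' + 1))"
proof -
  let ?f = "\<Prod>i\<in>{1..int p}. 1 - fps_const (a i) * fps_X"
  let ?g = "\<Prod>i\<in>{1..int (Suc p')}. 1 - fps_const (b i) * fps_X"
  have g0: "fps_nth ?g 0 = 1" 
    by (rule finite_induct[of "{1..int (Suc p')}"]) simp_all
  then have s: "subdegree ?g = 0" by (simp add: subdegree_eq_0_iff)
  have 1: "super_h k (map b [1..int p' + 1]) (map (\<lambda>i. - a i) [1..int p]) = fps_nth (?f / ?g) k" for k
  proof -
    have "(\<Prod>y\<leftarrow>map (\<lambda>i. - a i) [1..int p]. 1 + fps_const y * fps_X) = ?f"
      using prod.distinct_set_conv_list[of "[1..int p]" "\<lambda>i. 1 - fps_const (a i) * fps_X"]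
      by (simp add: o_def flip: fps_const_neg)
    moreover have "(\<Prod>x\<leftarrow>map b [1..int p' + 1]. 1 - fps_const x * fps_X) = ?g"
      using prod.distinct_set_conv_list[of "[1..int p' + 1]" "\<lambda>i. 1 - fps_const (b i) * fps_X"]
      by (simp add: o_def add.commute)
    ultimately show ?thesis by (simp add: super_h_def)
  qed
  have 2: "gen_power a (int p) = fls_X_intpow (- int p) * fps_to_fls ?f"
    using prod_factor_fps[of a p] by (simp add: gen_power_def)
  have 3: "gen_power b (int p' + 1) = fls_X_intpow (- int (Suc p')) * fps_to_fls ?g"
    using prod_factor_fps[of b "Suc p'"] by (simp add: gen_power_def add.commute)
  have 4: "(fls_X_intpow (- int p) :: complex fls) = fls_X_intpow (int p' + 1 - int p) * fls_X_intpow (- int (Suc p'))"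
    by (simp only: fls_X_intpow_times_fls_X_intpow) simp
  have cancel: "y \<noteq> 0 \<Longrightarrow> x * y * f / (y * g) = x * (f / g)" for x y f g :: "complex fls"
    by simp
  have "gen_power a (int p) / gen_power b (int p' + 1)
      = fls_X_intpow (int p' + 1 - int p) * (fps_to_fls ?f / fps_to_fls ?g)"
    unfolding 2 3 4 by (rule cancel, rule fls_X_intpow_nonzero)
  also have "fps_to_fls ?f / fps_to_fls ?g = fps_to_fls (?f / ?g)"
    by (rule fls_divide_fps_to_fls) (unfold s, rule zero_le)
  finally show ?thesis
    by (simp only: fls_X_intpow_times_conv_shift fls_shift_nth fps_to_fls_nth hook_coeff_def 1)
      (auto intro!: arg_cong[where f = "fps_nth _"])
qed

lemma super_h_uminus: "super_h k (map uminus xs) (map uminus ys) = (-1) ^ k * super_h k xs ys"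
proof -
  let ?m = "fps_const (-1) * fps_X :: complex fps"
  have Y: "(\<Prod>y\<leftarrow>ys. 1 + fps_const y * fps_X) oo ?m = (\<Prod>y\<leftarrow>map uminus ys. 1 + fps_const y * fps_X)" for ys :: "complex list"
    by (induction ys) (simp_all add: fps_compose_mult_distrib fps_compose_add_distrib)
  have X: "(\<Prod>x\<leftarrow>xs. 1 - fps_const x * fps_X) oo ?m = (\<Prod>x\<leftarrow>map uminus xs. 1 - fps_const x * fps_X)" for xs :: "complex list"
    by (induction xs) (simp_all add: fps_compose_mult_distrib fps_compose_sub_distrib)
  have X0: "fps_nth (\<Prod>x\<leftarrow>xs. 1 - fps_const x * fps_X) 0 = 1" for xs :: "complex list"
    by (induction xs) simp_all
  have "(\<Prod>y\<leftarrow>map uminus ys. 1 + fps_const y * fps_X) / (\<Prod>x\<leftarrow>map uminus xs. 1 - fps_const x * fps_X)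
     = ((\<Prod>y\<leftarrow>ys. 1 + fps_const y * fps_X) / (\<Prod>x\<leftarrow>xs. 1 - fps_const x * fps_X)) oo ?m"
    using X0[of xs] X0[of "map uminus xs"]
    by (simp only: fps_divide_unit zero_neq_one[symmetric] not_False_eq_True fps_compose_mult_distrib
        fps_inverse_compose X[symmetric] Y[symmetric]) (simp add: fps_compose_mult_distrib fps_inverse_compose fps_divide_unit)
  then show ?thesis by (simp only: super_h_def fps_nth_compose_linear)
qed

text \<open>
  The hatted sequences are the negatives of the reflected ones, and supersymmetric polynomials are
  homogeneous.
\<close>

lemma hook_coeff_hat:
  "hook_coeff (hat a) (hat b) q q' = (-1) ^ (q + q') * hook_coeff (\<lambda>i. a (1 - i)) (\<lambda>i. b (1 - i)) q q'"
proof (cases "q' \<le> q")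
  case True
  then have "even (q + q') = even (q - q')" by presburger
  then have "(-1) ^ (q + q') = ((-1) ^ (q - q') :: complex)"
    by (simp add: minus_one_power_iff)
  moreover have "map (hat b) [1..int q' + 1] = map uminus (map (\<lambda>i. b (1 - i)) [1..int q' + 1])"
     "map (\<lambda>i. - hat a i) [1..int q] = map uminus (map (\<lambda>i. - a (1 - i)) [1..int q])"
    by (simp_all add: hat_def)
  ultimately show ?thesis using True by (simp only: hook_coeff_def if_True super_h_uminus)
qed (simp add: hook_coeff_def)

lemma hook_coeff_above: "p < p' \<Longrightarrow> hook_coeff a b p p' = 0"
  by (simp add: hook_coeff_def)

lemma hook_coeff_same: "hook_coeff a b p p = 1"
proof -
  have "fls_nth (gen_power a (int p) * (1 / gen_power b (int p + 1))) (- int p - (- int p - 1))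
     = fls_nth (gen_power a (int p)) (- int p) * fls_nth (1 / gen_power b (int p + 1)) (- (- int p - 1))"
    by (rule top_coeff_mult) (use deg_le_gen_power gen_power_divide_deg[of b 0 b "int p + 1"] in simp_all)
  then show ?thesis
    using gen_power_top[of a "int p"] gen_power_top[of "\<lambda>i. b (1 - i)" "- (int p + 1)"]
    by (simp add: hook_coeff_eq_res gen_power_reflect add.commute)
qed

section \<open>Determinants\<close>

text \<open>
  Sets of Frobenius coordinates are listed in decreasing order, the first element having index
  \<open>0\<close>. Outside the range of the list the value is arbitrary.
\<close>

definition desc :: "nat set \<Rightarrow> nat \<Rightarrow> nat" where
  "desc P i = rev (sorted_list_of_set P) ! i"

lemma desc_bij_betw:
  assumes "finite P"
  shows "bij_betw (desc P) {0..<card P} P"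
  unfolding bij_betw_def
proof
  have len: "length (rev (sorted_list_of_set P)) = card P" by simp
  have dist: "distinct (rev (sorted_list_of_set P))" by simp
  show "inj_on (desc P) {0..<card P}"
    unfolding inj_on_def desc_def using nth_eq_iff_index_eq[OF dist] len by auto
  have "desc P ` {0..<card P} = set (rev (sorted_list_of_set P))"
    unfolding desc_def set_conv_nth len by auto
  then show "desc P ` {0..<card P} = P" using assms by simp
qed

lemma desc_in: "finite P \<Longrightarrow> i < card P \<Longrightarrow> desc P i \<in> P"
  using desc_bij_betw by (fastforce simp: bij_betw_def)

lemma desc_strict_antimono:
  assumes "i < j" "j < card P"
  shows "desc P j < desc P i"
proof -
  have "sorted_wrt (<) (sorted_list_of_set P)" by simp
  then have "sorted_wrt (\<lambda>x y. y < x) (rev (sorted_list_of_set P))"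
    by (simp add: sorted_wrt_rev)
  then show ?thesis using assms unfolding desc_def sorted_wrt_iff_nth_less by simp
qed

lemma sorted_list_of_set_insert_top:
  assumes "finite Q" "\<And>x. x \<in> Q \<Longrightarrow> x < (n::nat)"
  shows "sorted_list_of_set (insert n Q) = sorted_list_of_set Q @ [n]"
  by (rule sorted_distinct_set_unique) (use assms in \<open>auto simp: sorted_append less_imp_le
      simp del: sorted_list_of_set_insert_remove\<close>)

lemma desc_insert_top:
  assumes "finite Q" "\<And>x. x \<in> Q \<Longrightarrow> x < n"
  shows "desc (insert n Q) 0 = n" "desc (insert n Q) (Suc j) = desc Q j"
  by (simp_all add: desc_def sorted_list_of_set_insert_top[OF assms])

lemma desc_unique:
  assumes "\<And>i j. i < j \<Longrightarrow> j < d \<Longrightarrow> f j < f i" "i < d"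
  shows "desc (f ` {..<d}) i = f i"
proof -
  have "rev (sorted_list_of_set (f ` {..<d})) = map f [0..<d]"
  proof -
    have "sorted_wrt (\<lambda>x y. y < x) (map f [0..<d])"
      using assms(1) by (auto simp: sorted_wrt_iff_nth_less)
    then have s: "sorted_wrt (<) (rev (map f [0..<d]))"
      by (simp add: sorted_wrt_rev)
    then have "sorted_list_of_set (f ` {..<d}) = rev (map f [0..<d])"
      by (intro sorted_distinct_set_unique)
        (auto simp: strict_sorted_iff atLeast0LessThan simp del: rev_map)
    then show ?thesis by simp
  qed
  then show ?thesis using assms(2) by (simp add: desc_def)
qed

lemma permutes_less: "p permutes {0..<n} \<Longrightarrow> i < n \<Longrightarrow> p i < (n :: nat)"
  using permutes_in_image[of p "{0..<n}" i] by simp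

text \<open>
  Expanding the products in the Leibniz formula gives a sum over all maps \<open>f\<close> from row indices to
  summation indices. Maps that are not injective contribute determinants with equal rows. An
  injective map is the enumeration of its image composed with a permutation, and the sum over the
  permutations is the Leibniz formula for the other factor.
\<close>

lemma cauchy_binet:
  fixes A B :: "nat \<Rightarrow> nat \<Rightarrow> 'a :: comm_ring_1"
  shows "det (mat d d (\<lambda>(i, j). \<Sum>k<m. A i k * B k j)) =
    (\<Sum>P | P \<subseteq> {..<m} \<and> card P = d.
       det (mat d d (\<lambda>(i, j). A i (desc P j))) * det (mat d d (\<lambda>(i, j). B (desc P i) j)))"
proof -
  let ?I = "{0..<d}"
  let ?S = "\<lambda>p. signof p :: 'a"
  let ?F = "PiE ?I (\<lambda>_. {..<m})"
  let ?inj = "{f \<in> ?F. inj_on f ?I}"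
  let ?B = "\<lambda>f. det (mat d d (\<lambda>(i, j). B (f i) j))"
  let ?g = "\<lambda>f. (\<Prod>i\<in>?I. A i (f i)) * ?B f"
  let ?Ps = "{P. P \<subseteq> {..<m} \<and> card P = d}"
  have finF: "finite ?F" by (intro finite_PiE) auto
  have leib: "det (mat d d M) = (\<Sum>p | p permutes ?I. ?S p * (\<Prod>i\<in>?I. M (i, p i)))" for M :: "nat \<times> nat \<Rightarrow> 'a"
    using det_def'[of "mat d d M" d] by (auto simp: permutes_less intro!: sum.cong prod.cong)
  have "det (mat d d (\<lambda>(i, j). \<Sum>k<m. A i k * B k j))
     = (\<Sum>p | p permutes ?I. ?S p * (\<Prod>i\<in>?I. \<Sum>k<m. A i k * B k (p i)))"
    by (simp add: leib)
  also have "\<dots> = (\<Sum>p | p permutes ?I. \<Sum>f\<in>?F. ?S p * (\<Prod>i\<in>?I. A i (f i) * B (f i) (p i)))"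
    by (subst prod_sum_PiE) (simp_all add: sum_distrib_left)
  also have "\<dots> = (\<Sum>f\<in>?F. ?g f)"
    by (subst sum.swap) (simp add: leib sum_distrib_left prod.distrib mult_ac)
  also have "\<dots> = (\<Sum>f\<in>?inj. ?g f)"
  proof (rule sum.mono_neutral_right)
    show "\<forall>f\<in>?F - ?inj. ?g f = 0"
    proof
      fix f assume "f \<in> ?F - ?inj"
      then obtain i j where ij: "i < d" "j < d" "i \<noteq> j" "f i = f j"
        by (auto simp: inj_on_def)
      have "?B f = 0"
        by (rule det_identical_rows[of _ d i j]) (use ij in \<open>auto intro!: eq_vecI\<close>)
      then show "?g f = 0" by simp
    qed
  qed (use finF in auto)
  also have "\<dots> = (\<Sum>P\<in>?Ps. \<Sum>f | f \<in> ?inj \<and> f ` ?I = P. ?g f)"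
    by (rule sum.group[symmetric]) (use finF in \<open>auto simp: card_image\<close>)
  also have "\<dots> = (\<Sum>P\<in>?Ps. det (mat d d (\<lambda>(i, j). A i (desc P j))) * ?B (desc P))"
  proof (rule sum.cong[OF refl])
    fix P assume "P \<in> ?Ps"
    then have P: "P \<subseteq> {..<m}" "card P = d" "finite P" by (auto intro: finite_subset)
    have bij: "bij_betw (desc P) ?I P" using desc_bij_betw[OF P(3)] P(2) by simp
    have "(\<Sum>f | f \<in> ?inj \<and> f ` ?I = P. ?g f) = (\<Sum>p | p permutes ?I. ?g (desc P \<circ> p))"
    proof (rule sum.reindex_bij_witness[of _
        "\<lambda>p. restrict (desc P \<circ> p) ?I"
        "\<lambda>f i. if i < d then inv_into ?I (desc P) (f i) else i"])
      fix f assume f: "f \<in> {f \<in> ?inj. f ` ?I = P}"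
      define p where "p = (\<lambda>i. if i < d then inv_into ?I (desc P) (f i) else i)"
      have dp: "desc P (p i) = f i" if "i < d" for i
        using f that bij by (auto simp: p_def bij_betw_def f_inv_into_f)
      have ps: "p permutes ?I"
      proof (rule bij_imp_permutes)
        have "bij_betw f ?I P" using f by (auto simp: bij_betw_def)
        from bij_betw_trans[OF this bij_betw_inv_into[OF bij]]
        show "bij_betw p ?I ?I"
          by (rule bij_betw_cong[THEN iffD1, rotated]) (simp add: p_def)
      qed (simp add: p_def)
      show "(\<lambda>i. if i < d then inv_into ?I (desc P) (f i) else i) \<in> {p. p permutes ?I}"
        using ps by (simp add: p_def)
      show "restrict (desc P \<circ> (\<lambda>i. if i < d then inv_into ?I (desc P) (f i) else i)) ?I = f"
        using dp f by (auto simp: p_def fun_eq_iff restrict_def PiE_def extensional_def)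
      have "?B (desc P \<circ> p) = ?B f"
        by (intro arg_cong[where f = det] eq_matI) (auto simp: dp)
      moreover have "(\<Prod>i\<in>?I. A i ((desc P \<circ> p) i)) = (\<Prod>i\<in>?I. A i (f i))"
        by (rule prod.cong) (auto simp: dp)
      ultimately show "?g (desc P \<circ> (\<lambda>i. if i < d then inv_into ?I (desc P) (f i) else i)) = ?g f"
        by (simp add: p_def)
    next
      fix p assume "p \<in> {p. p permutes ?I}"
      then have p: "p permutes ?I" by simp
      then have pI: "bij_betw p ?I ?I" by (rule permutes_imp_bij)
      show "(\<lambda>i. if i < d then inv_into ?I (desc P) (restrict (desc P \<circ> p) ?I i) else i) = p"
        using p pI bij by (auto simp: fun_eq_iff bij_betw_def permutes_def inv_into_f_f)
      have b: "bij_betw (desc P \<circ> p) ?I P" by (rule bij_betw_trans[OF pI bij])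
      then show "restrict (desc P \<circ> p) ?I \<in> {f \<in> ?inj. f ` ?I = P}"
        using P(1) by (auto simp: bij_betw_def inj_on_def)
    qed
    also have "\<dots> = (\<Sum>p | p permutes ?I. (?S p * (\<Prod>i\<in>?I. A i (desc P (p i)))) * ?B (desc P))"
    proof (rule sum.cong[OF refl])
      fix p assume "p \<in> {p. p permutes ?I}"
      then have p: "p permutes ?I" by simp
      have "?B (desc P \<circ> p) = det (mat d d (\<lambda>(i, j). mat d d (\<lambda>(i, j). B (desc P i) j) $$ (p i, j)))"
        by (intro arg_cong[where f = det] eq_matI) (use p in \<open>auto dest: permutes_less\<close>)
      also have "\<dots> = ?S p * ?B (desc P)"
        by (rule det_permute_rows[OF _ p]) simp
      finally show "?g (desc P \<circ> p) = (?S p * (\<Prod>i\<in>?I. A i (desc P (p i)))) * ?B (desc P)"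
        by (simp add: mult_ac)
    qed
    also have "\<dots> = det (mat d d (\<lambda>(i, j). A i (desc P j))) * ?B (desc P)"
      by (simp add: leib sum_distrib_right)
    finally show "(\<Sum>f | f \<in> ?inj \<and> f ` ?I = P. ?g f)
        = det (mat d d (\<lambda>(i, j). A i (desc P j))) * ?B (desc P)" .
  qed
  finally show ?thesis .
qed

text \<open>
  The zero block has \<open>r + 1\<close> rows and leaves only \<open>r\<close> columns for them, so every permutation
  meets it.
\<close>

lemma det_zero_block:
  fixes A :: "nat \<Rightarrow> nat \<Rightarrow> 'a :: comm_ring_1"
  assumes "r < n" and zero: "\<And>i k. i \<le> r \<Longrightarrow> r \<le> k \<Longrightarrow> k < n \<Longrightarrow> A i k = 0"
  shows "det (mat n n (\<lambda>(i, k). A i k)) = 0"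
proof -
  have "(\<Prod>i = 0..<n. mat n n (\<lambda>(i, k). A i k) $$ (i, p i)) = 0" if p: "p permutes {0..<n}" for p
  proof -
    have "\<not> p ` {..r} \<subseteq> {..<r}"
    proof
      assume "p ` {..r} \<subseteq> {..<r}"
      then have "card (p ` {..r}) \<le> card {..<r}" by (intro card_mono) auto
      moreover have "card (p ` {..r}) = card {..r}"
        using permutes_inj[OF p] by (intro card_image) (auto simp: inj_on_def)
      ultimately show False by simp
    qed
    then obtain i where i: "i \<le> r" "r \<le> p i" by force
    moreover have "p i < n" using i assms(1) permutes_less[OF p] by auto
    ultimately have "mat n n (\<lambda>(i, k). A i k) $$ (i, p i) = 0" using assms by simp
    then show ?thesis using i assms(1) by (intro prod_zero) auto
  qed
  then show ?thesis by (subst det_def'[of _ n]) auto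
qed

text \<open>
  The unit rows select the columns outside \<open>Q\<close> in increasing order, so they leave the minor of
  the remaining rows in the columns of \<open>Q\<close>. The sign comes from Laplace expansion with respect to
  the last column, with index \<open>l\<close> say: if \<open>l\<close> is not in \<open>Q\<close>, the last row is a unit row and
  contributes no sign; otherwise column \<open>l\<close> is the first column of the minor, and the expansions
  of both sides along it differ by \<open>(-1)\<^sup>l\<close>.
\<close>

lemma det_unit_rows:
  fixes E :: "nat \<Rightarrow> nat \<Rightarrow> 'a :: comm_ring_1"
  assumes "Q \<subseteq> {..<N}"
  shows "det (mat N N (\<lambda>(i, k). if i < card Q then E i k
            else if k = sorted_list_of_set ({..<N} - Q) ! (i - card Q) then 1 else 0))
       = (\<Prod>q\<in>Q. (-1) ^ q) * det (mat (card Q) (card Q) (\<lambda>(i, j). E i (desc Q j)))"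
  using assms
proof (induction N arbitrary: Q E)
  case 0
  then show ?case by simp
next
  case (Suc N)
  let ?r = "sorted_list_of_set ({..<Suc N} - Q)"
  define f where "f = (\<lambda>(i, k). if i < card Q then E i k else if k = ?r ! (i - card Q) then 1 else 0)"
  let ?M = "mat (Suc N) (Suc N) f"
  have finQ: "finite Q" using Suc.prems finite_subset by blast
  show ?case
  proof (cases "N \<in> Q")
    case False
    then have Q: "Q \<subseteq> {..<N}" using Suc.prems by (auto simp: less_Suc_eq)
    then have d: "card Q \<le> N" using card_mono[of "{..<N}" Q] by simp
    have "{..<Suc N} - Q = insert N ({..<N} - Q)" using False by auto
    then have r: "?r = sorted_list_of_set ({..<N} - Q) @ [N]"
      by (simp only:) (rule sorted_list_of_set_insert_top; auto)
    have len: "length (sorted_list_of_set ({..<N} - Q)) = N - card Q"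
      using Q finQ by (simp add: card_Diff_subset)
    have last: "f (N, k) = (if k = N then 1 else 0)" for k
      using d len by (simp add: f_def r nth_append)
    have "det ?M = (\<Sum>k<Suc N. f (N, k) * cofactor ?M N k)"
      by (subst laplace_expansion_row[of _ "Suc N" N]) auto
    also have "\<dots> = cofactor ?M N N"
      by (simp add: last)
    also have "\<dots> = det (mat_delete ?M N N)"
      by (simp add: cofactor_def)
    also have "mat_delete ?M N N = mat N N (\<lambda>(i, k). if i < card Q then E i k
            else if k = sorted_list_of_set ({..<N} - Q) ! (i - card Q) then 1 else 0)"
      by (rule eq_matI) (use len in \<open>auto simp: mat_delete_def f_def r nth_append\<close>)
    also have "det \<dots> = (\<Prod>q\<in>Q. (-1) ^ q) * det (mat (card Q) (card Q) (\<lambda>(i, j). E i (desc Q j)))"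
      by (rule Suc.IH[OF Q])
    finally show ?thesis by (simp only: f_def)
  next
    case True
    define Q' where "Q' = Q - {N}"
    have Q': "Q' \<subseteq> {..<N}" "finite Q'" and Q: "Q = insert N Q'" and N: "N \<notin> Q'"
      using Suc.prems True finQ by (auto simp: Q'_def)
    define d where "d = card Q'"
    have dQ: "card Q = Suc d" using N Q' by (simp add: Q d_def)
    have less: "x < N" if "x \<in> Q'" for x using Q' that by auto
    have d: "d \<le> N" using card_mono[of "{..<N}" Q'] Q' by (simp add: d_def)
    have "{..<Suc N} - Q = {..<N} - Q'" using Q by auto
    then have r: "?r = sorted_list_of_set ({..<N} - Q')" by simp
    have len: "length ?r = N - d" using Q' by (simp add: r card_Diff_subset d_def)
    have r_less: "?r ! i < N" if "i < N - d" for i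
    proof -
      have "?r ! i \<in> set ?r" using that len by (intro nth_mem) simp
      then show ?thesis by (simp add: r)
    qed
    \<comment> \<open>Numbering of the rows after the deletion of row \<open>i\<close>.\<close>
    define skip where "skip = (\<lambda>i i'. if i' < i then i' else Suc i' :: nat)"
    have minor: "det (mat_delete ?M i N) = (\<Prod>q\<in>Q'. (-1) ^ q) *
        det (mat_delete (mat (Suc d) (Suc d) (\<lambda>(i, j). E i (desc Q j))) i 0)" if i: "i < Suc d" for i
    proof -
      have "mat_delete ?M i N = mat N N (\<lambda>(i', k). if i' < card Q' then E (skip i i') k
            else if k = sorted_list_of_set ({..<N} - Q') ! (i' - card Q') then 1 else 0)"
        by (rule eq_matI) (use i in \<open>auto simp: mat_delete_def f_def r skip_def dQ d_def[symmetric]\<close>)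
      then have "det (mat_delete ?M i N) = (\<Prod>q\<in>Q'. (-1) ^ q) *
          det (mat d d (\<lambda>(i', j). E (skip i i') (desc Q' j)))"
        by (simp only: Suc.IH[OF Q'(1)] d_def)
      also have "mat d d (\<lambda>(i', j). E (skip i i') (desc Q' j))
          = mat_delete (mat (Suc d) (Suc d) (\<lambda>(i, j). E i (desc Q j))) i 0"
        by (rule eq_matI) (use i in \<open>auto simp: mat_delete_def skip_def Q desc_insert_top[OF Q'(2) less]\<close>)
      finally show ?thesis .
    qed
    have "det ?M = (\<Sum>i<Suc N. f (i, N) * cofactor ?M i N)"
      by (subst laplace_expansion_column[of _ "Suc N" N]) auto
    also have "\<dots> = (\<Sum>i<Suc d. f (i, N) * cofactor ?M i N)"
    proof (rule sum.mono_neutral_right)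
      show "\<forall>i\<in>{..<Suc N} - {..<Suc d}. f (i, N) * cofactor ?M i N = 0"
      proof
        fix i assume i: "i \<in> {..<Suc N} - {..<Suc d}"
        then have "?r ! (i - Suc d) < N" by (intro r_less) auto
        then show "f (i, N) * cofactor ?M i N = 0" using i by (auto simp: f_def dQ)
      qed
    qed (use d in auto)
    also have "\<dots> = (\<Sum>i<Suc d. (-1) ^ N * (\<Prod>q\<in>Q'. (-1) ^ q) * (E i N *
        cofactor (mat (Suc d) (Suc d) (\<lambda>(i, j). E i (desc Q j))) i 0))"
    proof (rule sum.cong[OF refl])
      fix i assume "i \<in> {..<Suc d}"
      then have "f (i, N) = E i N" and i: "i < Suc d" by (simp_all add: f_def dQ)
      then show "f (i, N) * cofactor ?M i N = (-1) ^ N * (\<Prod>q\<in>Q'. (-1) ^ q) * (E i N *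
        cofactor (mat (Suc d) (Suc d) (\<lambda>(i, j). E i (desc Q j))) i 0)"
        by (simp add: cofactor_def minor[OF i] power_add mult_ac)
    qed
    also have "\<dots> = (-1) ^ N * (\<Prod>q\<in>Q'. (-1) ^ q) *
        det (mat (Suc d) (Suc d) (\<lambda>(i, j). E i (desc Q j)))"
      unfolding sum_distrib_left[symmetric]
      by (subst laplace_expansion_column[of _ "Suc d" 0])
        (auto simp: Q desc_insert_top[OF Q'(2) less] intro!: sum.cong)
    also have "(-1) ^ N * (\<Prod>q\<in>Q'. (-1) ^ q) = (\<Prod>q\<in>Q. (-1 :: 'a) ^ q)"
      using N Q' by (simp add: Q)
    finally show ?thesis by (simp only: f_def dQ)
  qed
qed

section \<open>Hook functions\<close>

text \<open>
  The entry of the Jacobi--Trudi matrix in column \<open>j\<close> (from \<open>0\<close>) and a row with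
  \<open>\<mu>\<^sub>i - i = n\<close>.
\<close>

definition jt_entry :: "(int \<Rightarrow> complex) \<Rightarrow> int \<Rightarrow> nat \<Rightarrow> symfun" where
  "jt_entry a n j = H_residue (gen_power a n / gen_power a (- int j))"

lemma jt_entry_h_multi: "h_multi (shift (1 - int (Suc j)) a) (n + int (Suc j)) = jt_entry a n j"
  by (simp add: h_multi_shift jt_entry_def)

lemma jt_entry_above: "j < k \<Longrightarrow> jt_entry a (- 1 - int k) j = 0"
  by (simp add: jt_entry_def H_residue_gen_power_quotient_low)

lemma jt_entry_diag [simp]: "jt_entry a (- 1 - int j) j = 1"
proof -
  have "- 1 - int j = - int j - 1" by simp
  then show ?thesis by (simp only: jt_entry_def H_residue_gen_power_quotient_pred)
qed

text \<open>
  The rows with \<open>n = -1, -2, \<dots>\<close>, those of the empty diagram, form an upper unitriangular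
  matrix. The entries below are the coordinates of the row \<open>p\<close> with respect to them, obtained by
  forward substitution; up to a sign they are the Schur functions of the hooks \<open>(p | j)\<close>.
\<close>

fun hook_fun :: "(int \<Rightarrow> complex) \<Rightarrow> nat \<Rightarrow> nat \<Rightarrow> symfun" where
  "hook_fun a p j = jt_entry a (int p) j - (\<Sum>k<j. hook_fun a p k * jt_entry a (- 1 - int k) j)"

declare hook_fun.simps [simp del]

lemma hook_fun_sum:
  assumes "j \<le> N"
  shows "(\<Sum>k\<le>N. hook_fun a p k * jt_entry a (- 1 - int k) j) = jt_entry a (int p) j"
proof -
  have "(\<Sum>k\<le>N. hook_fun a p k * jt_entry a (- 1 - int k) j) = (\<Sum>k\<le>j. hook_fun a p k * jt_entry a (- 1 - int k) j)"
    by (rule sum.mono_neutral_right) (use assms in \<open>auto simp: jt_entry_above\<close>)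
  also have "\<dots> = jt_entry a (int p) j"
    unfolding lessThan_Suc_atMost[symmetric] sum.lessThan_Suc by (subst (2) hook_fun.simps) simp
  finally show ?thesis .
qed

lemma hook_fun_unique:
  assumes "\<And>j. (\<Sum>k\<le>j. e k * jt_entry a (- 1 - int k) j) = jt_entry a (int p) j"
  shows "e j = hook_fun a p j"
proof (induction j rule: less_induct)
  case (less j)
  have "e j = jt_entry a (int p) j - (\<Sum>k<j. e k * jt_entry a (- 1 - int k) j)"
    using assms[of j] unfolding lessThan_Suc_atMost[symmetric] sum.lessThan_Suc
    by (simp add: algebra_simps)
  also have "\<dots> = hook_fun a p j"
    by (subst hook_fun.simps) (simp add: less)
  finally show ?case .
qed

text \<open>
  For a polynomial the Newton coefficients at negative powers are residues of polynomials, so they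
  vanish; the expansion can therefore be continued until the remainder is negligible.
\<close>

lemma prod_factor_expansion:
  assumes "finite S"
  shows "H_residue ((\<Prod>i\<in>S. factor (f i)) * G)
     = (\<Sum>l\<le>card S. scalar (res ((\<Prod>i\<in>S. factor (f i)) / gen_power b (int l + 1)))
          * H_residue (gen_power b (int l) * G))"
proof -
  obtain j where "\<forall>N\<ge>j. deg_le G (int N - 1)"
    using ex_deg_le by blast
  then have "deg_le G (int (Suc j) - 1)"
    by (meson le_SucI order_refl)
  then have G: "deg_le G (int j)"
    by simp
  let ?F = "\<Prod>i\<in>S. factor (f i)" and ?p = "card S"
  let ?c = "\<lambda>k. res (?F / gen_power b (k + 1))"
  let ?K = "{- int j - 1..int ?p}"
  have "deg_le (?F - (\<Sum>k\<in>?K. fls_const (?c k) * gen_power b k)) (- int j - 1 - 1)"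
    by (rule newton_expansion[OF prod_factor_top(1)[OF assms]])
  from deg_le_mult[OF this G]
  have "deg_le (?F * G - (\<Sum>k\<in>?K. fls_const (?c k) * (gen_power b k * G))) (- 2)"
    by (simp add: left_diff_distrib sum_distrib_right mult.assoc)
  then have "H_residue (?F * G) = (\<Sum>k\<in>?K. scalar (?c k) * H_residue (gen_power b k * G))"
    by (simp only: H_residue_cong H_residue_sum H_residue_smult)
  also have "\<dots> = (\<Sum>k\<in>{0..int ?p}. scalar (?c k) * H_residue (gen_power b k * G))"
  proof (rule sum.mono_neutral_right)
    show "\<forall>k\<in>?K - {0..int ?p}. scalar (?c k) * H_residue (gen_power b k * G) = 0"
    proof
      fix k assume "k \<in> ?K - {0..int ?p}"
      then have "poly_in_u (1 / gen_power b (k + 1))"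
        using poly_in_u_gen_power_quotient[of "k + 1" 0 b] by auto
      from poly_in_u_prod_mult[OF assms this, of f]
      have "?c k = 0" by (intro res_poly_in_u) simp
      then show "scalar (?c k) * H_residue (gen_power b k * G) = 0" by simp
    qed
  qed auto
  also have "\<dots> = (\<Sum>l\<le>?p. scalar (?c (int l)) * H_residue (gen_power b (int l) * G))"
    by (rule sum.reindex_bij_witness[of _ int nat]) auto
  finally show ?thesis .
qed

lemma gen_power_nonneg_expansion:
  "H_residue (gen_power a (int p) * G)
     = (\<Sum>p'\<le>p. scalar (hook_coeff a b p p') * H_residue (gen_power b (int p') * G))"
  using prod_factor_expansion[of "{1..int p}" a G b]
  by (simp add: hook_coeff_eq_res gen_power_def[of a])

abbreviation reflect :: "(int \<Rightarrow> complex) \<Rightarrow> int \<Rightarrow> complex" where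
  "reflect a \<equiv> \<lambda>i. a (1 - i)"

text \<open>The change of the columns: \<open>1 / (u|a)\<^sup>-\<^sup>j\<close> is the \<open>j\<close>-th power for the reflected sequence.\<close>

lemma gen_power_column_expansion:
  "H_residue (F / gen_power a (- int j))
     = (\<Sum>l\<le>j. scalar (hook_coeff (reflect a) (reflect b) j l) * H_residue (F / gen_power b (- int l)))"
  using gen_power_nonneg_expansion[of "reflect a" j F "reflect b"]
  by (simp add: gen_power_reflect)

text \<open>
  The change of the rows with negative index. Powers below \<open>-1-j\<close> are negligible in column \<open>j\<close>,
  which makes the sum finite.
\<close>

lemma gen_power_neg_expansion:
  "H_residue (gen_power b (- 1 - int i) / gen_power a (- int j))
     = (\<Sum>k\<le>j. scalar (hook_coeff (reflect a) (reflect b) k i) * jt_entry a (- 1 - int k) j)"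
proof -
  let ?F = "gen_power b (- 1 - int i)" and ?G = "1 / gen_power a (- int j)"
  let ?c = "\<lambda>k. res (?F / gen_power a (k + 1))"
  let ?K = "{- 1 - int j..- 1 - int i}"
  have G: "deg_le ?G (int j)"
    using gen_power_divide_deg[of a 0 a "- int j"] by simp
  have "deg_le (?F - (\<Sum>k\<in>?K. fls_const (?c k) * gen_power a k)) (- 1 - int j - 1)"
    by (rule newton_expansion[OF deg_le_gen_power])
  from deg_le_mult[OF this G]
  have "deg_le (?F * ?G - (\<Sum>k\<in>?K. fls_const (?c k) * (gen_power a k * ?G))) (- 2)"
    by (simp only: left_diff_distrib sum_distrib_right mult.assoc) simp
  then have "H_residue (?F * ?G) = (\<Sum>k\<in>?K. scalar (?c k) * H_residue (gen_power a k * ?G))"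
    by (simp only: H_residue_cong H_residue_sum H_residue_smult)
  also have "\<dots> = (\<Sum>k\<in>{i..j}. scalar (?c (- 1 - int k)) * jt_entry a (- 1 - int k) j)"
    by (rule sum.reindex_bij_witness[of _ "\<lambda>k. - 1 - int k" "\<lambda>k. nat (- 1 - k)"]) (auto simp: jt_entry_def)
  also have "\<dots> = (\<Sum>k\<in>{i..j}. scalar (hook_coeff (reflect a) (reflect b) k i) * jt_entry a (- 1 - int k) j)"
    by (rule sum.cong) (simp_all add: hook_coeff_eq_res gen_power_reflect minus_diff_commute)
  also have "\<dots> = (\<Sum>k\<le>j. scalar (hook_coeff (reflect a) (reflect b) k i) * jt_entry a (- 1 - int k) j)"
    by (rule sum.mono_neutral_left) (auto simp: hook_coeff_above)
  finally show ?thesis by simp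
qed

text \<open>
  The relation that defines the hook functions for \<open>b\<close> is linear in the columns, so it also
  holds for the columns that belong to \<open>a\<close>.
\<close>

lemma hook_fun_sum_mixed:
  "(\<Sum>i\<le>j. hook_fun b p i * H_residue (gen_power b (- 1 - int i) / gen_power a (- int j)))
     = H_residue (gen_power b (int p) / gen_power a (- int j))"
proof -
  let ?v = "\<lambda>l. scalar (hook_coeff (reflect a) (reflect b) j l)"
  have "(\<Sum>i\<le>j. hook_fun b p i * H_residue (gen_power b (- 1 - int i) / gen_power a (- int j)))
      = (\<Sum>i\<le>j. \<Sum>l\<le>j. ?v l * (hook_fun b p i * jt_entry b (- 1 - int i) l))"
    by (simp only: gen_power_column_expansion[of _ a j b] jt_entry_def[symmetric] sum_distrib_left mult_ac)
  also have "\<dots> = (\<Sum>l\<le>j. ?v l * (\<Sum>i\<le>j. hook_fun b p i * jt_entry b (- 1 - int i) l))"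
    by (subst sum.swap) (simp only: sum_distrib_left)
  also have "\<dots> = (\<Sum>l\<le>j. ?v l * jt_entry b (int p) l)"
    by (rule sum.cong) (simp_all add: hook_fun_sum)
  finally show ?thesis
    by (simp only: gen_power_column_expansion[of "gen_power b (int p)" a j b] jt_entry_def)
qed

text \<open>
  Both sides solve the same triangular system: the sum over \<open>k\<close> collects the rows with negative
  index for \<open>a\<close> into those for \<open>b\<close>, where the hook functions for \<open>b\<close> reproduce the rows
  \<open>p'\<close> for \<open>b\<close>, and these combine to the row \<open>p\<close> for \<open>a\<close>.
\<close>

lemma hook_fun_transition:
  "hook_fun a p k = (\<Sum>p'\<le>p. \<Sum>i\<le>k. scalar (hook_coeff a b p p') * hook_fun b p' i
      * scalar (hook_coeff (reflect a) (reflect b) k i))"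
proof (rule hook_fun_unique[symmetric])
  fix j
  let ?C = "\<lambda>p'. scalar (hook_coeff a b p p')" and ?K = "\<lambda>k i. scalar (hook_coeff (reflect a) (reflect b) k i)"
  have "(\<Sum>k\<le>j. (\<Sum>p'\<le>p. \<Sum>i\<le>k. ?C p' * hook_fun b p' i * ?K k i) * jt_entry a (- 1 - int k) j)
      = (\<Sum>k\<le>j. (\<Sum>p'\<le>p. \<Sum>i\<le>j. ?C p' * hook_fun b p' i * ?K k i) * jt_entry a (- 1 - int k) j)"
    by (intro sum.cong arg_cong2[where f = "(*)"] refl sum.mono_neutral_left) (auto simp: hook_coeff_above)
  also have "\<dots> = (\<Sum>k\<le>j. \<Sum>p'\<le>p. \<Sum>i\<le>j. ?C p' * (hook_fun b p' i * (?K k i * jt_entry a (- 1 - int k) j)))"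
    by (simp only: sum_distrib_right mult.assoc)
  also have "\<dots> = (\<Sum>p'\<le>p. \<Sum>i\<le>j. \<Sum>k\<le>j. ?C p' * (hook_fun b p' i * (?K k i * jt_entry a (- 1 - int k) j)))"
    by (subst sum.swap) (intro sum.cong refl sum.swap)
  also have "\<dots> = (\<Sum>p'\<le>p. ?C p' * (\<Sum>i\<le>j. hook_fun b p' i * (\<Sum>k\<le>j. ?K k i * jt_entry a (- 1 - int k) j)))"
    by (simp only: sum_distrib_left)
  also have "\<dots> = (\<Sum>p'\<le>p. ?C p' * H_residue (gen_power b (int p') / gen_power a (- int j)))"
    by (simp only: gen_power_neg_expansion[symmetric] hook_fun_sum_mixed)
  also have "\<dots> = jt_entry a (int p) j"
    using gen_power_nonneg_expansion[of a p "1 / gen_power a (- int j)" b] by (simp add: jt_entry_def)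
  finally show "(\<Sum>k\<le>j. (\<Sum>p'\<le>p. \<Sum>i\<le>k. ?C p' * hook_fun b p' i * ?K k i) * jt_entry a (- 1 - int k) j)
      = jt_entry a (int p) j" .
qed

section \<open>Diagrams and Frobenius coordinates\<close>

lemma initial_segment:
  assumes "finite S" "S \<subseteq> {1..}" "\<And>x y. x \<in> S \<Longrightarrow> 1 \<le> y \<Longrightarrow> y \<le> x \<Longrightarrow> y \<in> S"
  shows "S = {1..card S :: nat}"
proof (cases "S = {}")
  case False
  have "S = {1..Max S}"
  proof
    show "S \<subseteq> {1..Max S}" using assms by auto
    show "{1..Max S} \<subseteq> S" using assms(3)[OF Max_in[OF assms(1) False]] by auto
  qed
  then show ?thesis by (metis card_atLeastAtMost diff_Suc_1)
qed simp

lemma young_diagramD: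
  assumes "young_diagram D"
  shows "finite D" "(i, j) \<in> D \<Longrightarrow> 1 \<le> i \<and> 1 \<le> j"
    "(i, j) \<in> D \<Longrightarrow> 1 \<le> i' \<Longrightarrow> i' \<le> i \<Longrightarrow> 1 \<le> j' \<Longrightarrow> j' \<le> j \<Longrightarrow> (i', j') \<in> D"
  using assms unfolding young_diagram_def by blast+

lemma mem_diagram_iff:
  assumes "young_diagram D"
  shows "(i, j) \<in> D \<longleftrightarrow> 1 \<le> j \<and> j \<le> row_length D i"
proof -
  have "{j. (i, j) \<in> D} = {1..card {j. (i, j) \<in> D}}"
  proof (rule initial_segment)
    show "finite {j. (i, j) \<in> D}"
      by (rule finite_subset[of _ "snd ` D"]) (use young_diagramD(1)[OF assms] in force)+
    show "{j. (i, j) \<in> D} \<subseteq> {1..}"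
      using young_diagramD(2)[OF assms] by auto
    show "y \<in> {j. (i, j) \<in> D}" if "x \<in> {j. (i, j) \<in> D}" "1 \<le> y" "y \<le> x" for x y
      using young_diagramD(2)[OF assms, of i x] young_diagramD(3)[OF assms, of i x i y] that by simp
  qed
  from arg_cong[OF this, of "\<lambda>S. j \<in> S"] show ?thesis by (simp add: row_length_def)
qed

lemma mem_diag_iff:
  assumes "young_diagram D"
  shows "(i, i) \<in> D \<longleftrightarrow> 1 \<le> i \<and> i \<le> diag_size D"
proof -
  have "{i. (i, i) \<in> D} = {1..card {i. (i, i) \<in> D}}"
  proof (rule initial_segment)
    show "finite {i. (i, i) \<in> D}"
      by (rule finite_subset[of _ "snd ` D"]) (use young_diagramD(1)[OF assms] in force)+
    show "{i. (i, i) \<in> D} \<subseteq> {1..}"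
      using young_diagramD(2)[OF assms] by auto
    show "y \<in> {i. (i, i) \<in> D}" if "x \<in> {i. (i, i) \<in> D}" "1 \<le> y" "y \<le> x" for x y
      using young_diagramD(3)[OF assms, of x x y y] that by simp
  qed
  from arg_cong[OF this, of "\<lambda>S. i \<in> S"] show ?thesis by (simp add: diag_size_def)
qed

lemma mem_transposed [simp]: "(i, j) \<in> transposed D \<longleftrightarrow> (j, i) \<in> D"
  by (auto simp: transposed_def)

lemma young_diagram_transposed:
  assumes "young_diagram D"
  shows "young_diagram (transposed D)"
  unfolding young_diagram_def
proof (intro conjI)
  show "finite (transposed D)"
    by (rule finite_subset[of _ "prod.swap ` D"])
      (use young_diagramD(1)[OF assms] in \<open>auto simp: transposed_def\<close>)
  show "transposed D \<subseteq> {1..} \<times> {1..}"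
    using young_diagramD(2)[OF assms] by auto
  show "\<forall>i j i' j'. (i, j) \<in> transposed D \<longrightarrow> 1 \<le> i' \<longrightarrow> i' \<le> i \<longrightarrow> 1 \<le> j' \<longrightarrow> j' \<le> j
      \<longrightarrow> (i', j') \<in> transposed D"
    unfolding mem_transposed using young_diagramD(3)[OF assms] by blast
qed

lemma diag_size_transposed [simp]: "diag_size (transposed D) = diag_size D"
  by (simp add: diag_size_def)

lemma frob_q_transposed: "frob_q D i = frob_p (transposed D) i"
  by (simp add: frob_q_def frob_p_def)

lemma row_length_antimono:
  assumes "young_diagram D" "1 \<le> i" "i \<le> j"
  shows "row_length D j \<le> row_length D i"
proof (cases "row_length D j = 0")
  case False
  then have "(j, row_length D j) \<in> D" using mem_diagram_iff[OF assms(1)] by simp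
  then have "(i, row_length D j) \<in> D" using young_diagramD(3)[OF assms(1)] assms False by auto
  then show ?thesis using mem_diagram_iff[OF assms(1)] by simp
qed simp

lemma le_row_length_iff:
  assumes "young_diagram D" "1 \<le> i"
  shows "i \<le> row_length D i \<longleftrightarrow> i \<le> diag_size D"
  using mem_diag_iff[OF assms(1), of i] mem_diagram_iff[OF assms(1), of i i] assms(2) by auto

lemma frob_p_add: "young_diagram D \<Longrightarrow> i < diag_size D \<Longrightarrow> frob_p D (Suc i) + Suc i = row_length D (Suc i)"
  using le_row_length_iff[of D "Suc i"] by (simp add: frob_p_def)

lemma frob_p_strict_antimono:
  assumes "young_diagram D" "i < j" "j < diag_size D"
  shows "frob_p D (Suc j) < frob_p D (Suc i)"
  using row_length_antimono[OF assms(1), of "Suc i" "Suc j"]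
    frob_p_add[OF assms(1), of i] frob_p_add[OF assms(1), of j] assms by simp

definition arms :: "(nat \<times> nat) set \<Rightarrow> nat set" where
  "arms D = (\<lambda>i. frob_p D (Suc i)) ` {..<diag_size D}"

definition legs :: "(nat \<times> nat) set \<Rightarrow> nat set" where
  "legs D = (\<lambda>i. frob_q D (Suc i)) ` {..<diag_size D}"

lemma legs_transposed: "legs D = arms (transposed D)"
  by (simp add: legs_def arms_def frob_q_transposed)

lemma desc_arms: "young_diagram D \<Longrightarrow> i < diag_size D \<Longrightarrow> desc (arms D) i = frob_p D (Suc i)"
  unfolding arms_def using desc_unique[of "diag_size D" "\<lambda>i. frob_p D (Suc i)" i] frob_p_strict_antimono
  by blast

lemma desc_legs: "young_diagram D \<Longrightarrow> i < diag_size D \<Longrightarrow> desc (legs D) i = frob_q D (Suc i)"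
  by (simp add: legs_transposed desc_arms young_diagram_transposed frob_q_transposed)

lemma card_arms: "young_diagram D \<Longrightarrow> card (arms D) = diag_size D"
proof -
  assume D: "young_diagram D"
  have "inj_on (\<lambda>i. frob_p D (Suc i)) {..<diag_size D}"
    by (intro inj_onI) (metis D frob_p_strict_antimono lessThan_iff nat_neq_iff)
  then show ?thesis by (simp add: arms_def card_image)
qed

lemma card_legs: "young_diagram D \<Longrightarrow> card (legs D) = diag_size D"
  by (simp add: legs_transposed card_arms young_diagram_transposed)

lemma finite_arms [simp]: "finite (arms D)" and finite_legs [simp]: "finite (legs D)"
  by (simp_all add: arms_def legs_def)

text \<open>
  The union of the hooks \<open>(p\<^sub>i | q\<^sub>i)\<close> placed along the diagonal, with the boxes described by the
  arm for \<open>i \<le> j\<close> and by the leg for \<open>j \<le> i\<close>.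
\<close>

definition diagram_of :: "nat set \<Rightarrow> nat set \<Rightarrow> (nat \<times> nat) set" where
  "diagram_of P Q = {(i, j). 1 \<le> i \<and> 1 \<le> j \<and>
     (i \<le> j \<and> i \<le> card P \<and> j \<le> desc P (i - 1) + i \<or> j \<le> i \<and> j \<le> card Q \<and> i \<le> desc Q (j - 1) + j)}"

lemma transposed_diagram_of: "transposed (diagram_of P Q) = diagram_of Q P"
  by (auto simp: diagram_of_def)

lemma diagram_of_frobenius:
  assumes D: "young_diagram D"
  shows "diagram_of (arms D) (legs D) = D"
proof -
  have half: "i \<le> card (arms D) \<and> j \<le> desc (arms D) (i - 1) + i \<longleftrightarrow> (i, j) \<in> D"
    if D: "young_diagram D" and ij: "1 \<le> i" "i \<le> j" for D i j
  proof (cases "i \<le> diag_size D")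
    case True
    then obtain i' where "i = Suc i'" "i' < diag_size D" using ij by (cases i) auto
    then show ?thesis
      using ij True frob_p_add[OF D, of i'] by (simp add: desc_arms[OF D] card_arms[OF D] mem_diagram_iff[OF D])
  next
    case False
    then have "(i, i) \<notin> D" using mem_diag_iff[OF D] by simp
    then have "(i, j) \<notin> D" using young_diagramD(3)[OF D] ij by blast
    then show ?thesis using False by (simp add: card_arms[OF D])
  qed
  have "(i, j) \<in> diagram_of (arms D) (legs D) \<longleftrightarrow> (i, j) \<in> D" for i j
    using half[OF D, of i j] half[OF young_diagram_transposed[OF D], of j i] young_diagramD(2)[OF D, of i j]
    unfolding legs_transposed diagram_of_def by (cases "i \<le> j"; cases "j \<le> i") auto
  then show ?thesis by auto
qed

lemma desc_add_antimono:
  assumes "i \<le> j" "j < card P"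
  shows "desc P j + j \<le> desc P i + i"
  using assms
proof (induction j rule: dec_induct)
  case (step n)
  then show ?case using desc_strict_antimono[of n "Suc n" P] by simp
qed simp

text \<open>
  The ends \<open>p\<^sub>i + i\<close> of the arms do not increase with \<open>i\<close>, and every leg reaches down at
  least to the row of the last diagonal box; so boxes above or to the left stay inside, even across the diagonal.
\<close>

lemma young_diagram_diagram_of:
  assumes "finite P" "finite Q" "card P = card Q"
  shows "young_diagram (diagram_of P Q)"
  unfolding young_diagram_def
proof (intro conjI)
  have half: "i' \<le> j' \<and> i' \<le> card P \<and> j' \<le> desc P (i' - 1) + i' \<or> j' \<le> i' \<and> j' \<le> card Q \<and> i' \<le> desc Q (j' - 1) + j'"
    if "card P = card Q" "i \<le> j" "i \<le> card P" "j \<le> desc P (i - 1) + i" "1 \<le> i'" "i' \<le> i" "1 \<le> j'" "j' \<le> j"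
    for P Q i j i' j'
  proof (cases "i' \<le> j'")
    case True
    have "desc P (i - 1) + (i - 1) \<le> desc P (i' - 1) + (i' - 1)"
      by (rule desc_add_antimono) (use that in auto)
    then show ?thesis using True that by auto
  next
    case False
    have "desc Q (card Q - 1) + (card Q - 1) \<le> desc Q (j' - 1) + (j' - 1)"
      by (rule desc_add_antimono) (use that False in auto)
    then show ?thesis using False that by auto
  qed
  show "diagram_of P Q \<subseteq> {1..} \<times> {1..}"
    by (auto simp: diagram_of_def)
  show "\<forall>i j i' j'. (i, j) \<in> diagram_of P Q \<longrightarrow> 1 \<le> i' \<longrightarrow> i' \<le> i \<longrightarrow> 1 \<le> j' \<longrightarrow> j' \<le> j
      \<longrightarrow> (i', j') \<in> diagram_of P Q"
  proof (intro allI impI)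
    fix i j i' j'
    assume *: "(i, j) \<in> diagram_of P Q" "1 \<le> i'" "i' \<le> i" "1 \<le> j'" "j' \<le> j"
    from * consider "i \<le> j" "i \<le> card P" "j \<le> desc P (i - 1) + i"
      | "j \<le> i" "j \<le> card Q" "i \<le> desc Q (j - 1) + j"
      by (auto simp: diagram_of_def)
    then show "(i', j') \<in> diagram_of P Q"
    proof cases
      case 1
      from half[OF assms(3) 1 *(2-5)] * show ?thesis by (simp add: diagram_of_def)
    next
      case 2
      from half[OF assms(3)[symmetric] 2 *(4,5,2,3)] * show ?thesis by (auto simp: diagram_of_def)
    qed
  qed
  have bound: "desc P (i - 1) + i \<le> desc P 0 + 1" if "1 \<le> i" "i \<le> card P" for P i
  proof -
    have "i - 1 < card P" using that by simp
    from desc_add_antimono[OF le0 this] show ?thesis using that by simp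
  qed
  define K where "K = desc P 0 + desc Q 0 + 1"
  have "i \<le> K \<and> j \<le> K" if "(i, j) \<in> diagram_of P Q" for i j
  proof -
    from that consider "1 \<le> i" "i \<le> j" "i \<le> card P" "j \<le> desc P (i - 1) + i"
      | "1 \<le> j" "j \<le> i" "j \<le> card Q" "i \<le> desc Q (j - 1) + j"
      by (auto simp: diagram_of_def)
    then show ?thesis
    proof cases
      case 1
      then show ?thesis using bound[of i P] by (simp add: K_def)
    next
      case 2
      then show ?thesis using bound[of j Q] by (simp add: K_def)
    qed
  qed
  then have "diagram_of P Q \<subseteq> {..K} \<times> {..K}" by auto
  then show "finite (diagram_of P Q)" by (rule finite_subset) simp
qed

lemma diag_size_diagram_of:
  assumes "card P = card Q"
  shows "diag_size (diagram_of P Q) = card P"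
proof -
  have "{i. (i, i) \<in> diagram_of P Q} = {1..card P}"
    using assms by (auto simp: diagram_of_def)
  then show ?thesis by (simp add: diag_size_def)
qed

lemma frob_p_diagram_of:
  assumes "finite P" "finite Q" "card P = card Q" "i < card P"
  shows "frob_p (diagram_of P Q) (Suc i) = desc P i"
proof -
  let ?D = "diagram_of P Q"
  have D: "young_diagram ?D" by (rule young_diagram_diagram_of[OF assms(1-3)])
  have le: "Suc i \<le> row_length ?D (Suc i)"
    using le_row_length_iff[OF D, of "Suc i"] diag_size_diagram_of[OF assms(3)] assms(4) by simp
  have "(Suc i, j) \<in> ?D \<longleftrightarrow> j \<le> desc P i + Suc i" if "Suc i < j" for j
    using that assms(4) by (auto simp: diagram_of_def)
  then have "j \<le> row_length ?D (Suc i) \<longleftrightarrow> j \<le> desc P i + Suc i" if "Suc i < j" for j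
    using that mem_diagram_iff[OF D, of "Suc i" j] by auto
  then have "row_length ?D (Suc i) = desc P i + Suc i"
    using le by (metis le_add2 le_antisym le_less nle_le)
  then show ?thesis by (simp add: frob_p_def)
qed

lemma image_desc: "finite P \<Longrightarrow> desc P ` {..<card P} = P"
  using desc_bij_betw[of P] by (simp add: bij_betw_def atLeast0LessThan)

lemma arms_diagram_of:
  assumes "finite P" "finite Q" "card P = card Q"
  shows "arms (diagram_of P Q) = P"
proof -
  have "(\<lambda>i. frob_p (diagram_of P Q) (Suc i)) ` {..<card P} = desc P ` {..<card P}"
    by (intro image_cong) (simp_all add: frob_p_diagram_of[OF assms])
  then show ?thesis by (simp add: arms_def diag_size_diagram_of[OF assms(3)] image_desc[OF assms(1)])
qed

lemma legs_diagram_of: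
  assumes "finite P" "finite Q" "card P = card Q"
  shows "legs (diagram_of P Q) = Q"
  using arms_diagram_of[of Q P] assms by (simp add: legs_transposed transposed_diagram_of)

lemma diagram_subset_if_frobenius_le:
  assumes D: "young_diagram D" and E: "young_diagram E" and d: "diag_size E = diag_size D"
    and p: "\<And>i. i < diag_size D \<Longrightarrow> frob_p E (Suc i) \<le> frob_p D (Suc i)"
    and q: "\<And>i. i < diag_size D \<Longrightarrow> frob_q E (Suc i) \<le> frob_q D (Suc i)"
  shows "E \<subseteq> D"
proof -
  have le: "desc (arms E) i \<le> desc (arms D) i" "desc (legs E) i \<le> desc (legs D) i"
    if "i < diag_size D" for i
    using that p q d D E by (simp_all add: desc_arms desc_legs)
  have "(i, j) \<in> diagram_of (arms D) (legs D)" if ij: "(i, j) \<in> diagram_of (arms E) (legs E)" for i j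
  proof -
    from ij have 1: "1 \<le> i" "1 \<le> j" by (simp_all add: diagram_of_def)
    from ij consider "i \<le> j" "i \<le> diag_size D" "j \<le> desc (arms E) (i - 1) + i"
      | "j \<le> i" "j \<le> diag_size D" "i \<le> desc (legs E) (j - 1) + j"
      by (auto simp: diagram_of_def card_arms card_legs D E d)
    then show ?thesis
    proof cases
      case 1
      moreover have "i - 1 < diag_size D" using 1 \<open>1 \<le> i\<close> by simp
      ultimately show ?thesis using le(1)[of "i - 1"] \<open>1 \<le> i\<close> \<open>1 \<le> j\<close>
        by (simp add: diagram_of_def card_arms D)
    next
      case 2
      moreover have "j - 1 < diag_size D" using 2 \<open>1 \<le> j\<close> by simp
      ultimately show ?thesis using le(2)[of "j - 1"] \<open>1 \<le> i\<close> \<open>1 \<le> j\<close>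
        by (simp add: diagram_of_def card_legs D)
    qed
  qed
  then have "diagram_of (arms E) (legs E) \<subseteq> diagram_of (arms D) (legs D)" by auto
  then show ?thesis by (simp add: diagram_of_frobenius D E)
qed

text \<open>The index \<open>\<mu>\<^sub>i - i\<close> of the Jacobi--Trudi row, with rows numbered from \<open>0\<close>.\<close>

definition bead :: "(nat \<times> nat) set \<Rightarrow> nat \<Rightarrow> int" where
  "bead D i = int (row_length D (Suc i)) - int (Suc i)"

lemma bead_strict_antimono: "young_diagram D \<Longrightarrow> i < j \<Longrightarrow> bead D j < bead D i"
  using row_length_antimono[of D "Suc i" "Suc j"] by (simp add: bead_def)

lemma bead_frob_p: "young_diagram D \<Longrightarrow> i < diag_size D \<Longrightarrow> bead D i = int (frob_p D (Suc i))"
  using frob_p_add[of D i] by (simp add: bead_def)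

lemma legs_less:
  assumes "young_diagram D" "num_rows D \<le> N"
  shows "legs D \<subseteq> {..<N}"
proof
  fix q assume "q \<in> legs D"
  then obtain i where i: "i < diag_size D" "q = frob_p (transposed D) (Suc i)"
    by (auto simp: legs_def frob_q_transposed)
  let ?r = "row_length (transposed D) (Suc i)"
  have r: "q + Suc i = ?r"
    using frob_p_add[OF young_diagram_transposed[OF assms(1)]] i by simp
  then have "(Suc i, ?r) \<in> transposed D"
    using mem_diagram_iff[OF young_diagram_transposed[OF assms(1)], of "Suc i" ?r] by simp
  then have "row_length D ?r \<noteq> 0" using mem_diagram_iff[OF assms(1), of ?r "Suc i"] by auto
  then have "?r \<le> num_rows D" using num_rows_less_row_length_0[OF assms(1), of ?r] by force
  then show "q \<in> {..<N}" using r assms(2) by simp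
qed

text \<open>
  The numbers \<open>i - 1 - \<mu>\<^sub>i\<close> of the rows below the diagonal square and the legs \<open>\<mu>'\<^sub>j - j\<close> are
  complementary in \<open>{0..<N}\<close>. They are disjoint because \<open>\<mu>\<^sub>i + \<mu>'\<^sub>j = i + j - 1\<close> never
  holds: the left side is at least \<open>i + j\<close> if the box \<open>(i, j)\<close> belongs to the diagram, and at
  most \<open>i + j - 2\<close> otherwise. Together there are \<open>N\<close> of them.
\<close>

lemma bead_negative:
  assumes D: "young_diagram D" and N: "num_rows D \<le> N" and i: "diag_size D \<le> i" "i < N"
  shows "bead D i = - 1 - int (sorted_list_of_set ({..<N} - legs D) ! (i - diag_size D))"
proof -
  let ?d = "diag_size D"
  \<comment> \<open>The columns that the unit rows occupy; they increase with the row.\<close>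
  define r where "r = (\<lambda>k. nat (- 1 - bead D (k + ?d)))"
  have neg: "bead D k < 0" if "?d \<le> k" for k
    using le_row_length_iff[OF D, of "Suc k"] that by (auto simp: bead_def)
  then have r: "int (r k) = - 1 - bead D (k + ?d)" for k
    by (simp add: r_def) (smt (verit) neg le_add2)
  have mono: "r k < r l" if "k < l" for k l
    using bead_strict_antimono[OF D, of "k + ?d" "l + ?d"] r[of k] r[of l] that by linarith
  have inj: "inj_on r A" for A
    by (intro inj_onI) (metis mono nat_neq_iff less_irrefl)
  have "r ` {..<N - ?d} \<subseteq> {..<N} - legs D"
  proof safe
    fix k assume k: "k < N - ?d"
    show "r k < N" using r[of k] k by (simp add: bead_def)
    assume "r k \<in> legs D"
    then obtain j where j: "j < ?d" "r k = frob_p (transposed D) (Suc j)"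
      by (auto simp: legs_def frob_q_transposed)
    have "r k + Suc j = row_length (transposed D) (Suc j)"
      using frob_p_add[OF young_diagram_transposed[OF D]] j by simp
    moreover have "int (r k) = int (k + ?d) - int (row_length D (Suc (k + ?d)))"
      using r[of k] by (simp add: bead_def)
    ultimately have "int (row_length D (Suc (k + ?d))) + int (row_length (transposed D) (Suc j))
        = int (k + ?d) + int (Suc j)" by linarith
    moreover have "Suc (k + ?d) \<le> row_length (transposed D) (Suc j) \<longleftrightarrow> Suc j \<le> row_length D (Suc (k + ?d))"
      using mem_diagram_iff[OF D, of "Suc (k + ?d)" "Suc j"]
        mem_diagram_iff[OF young_diagram_transposed[OF D], of "Suc j" "Suc (k + ?d)"] by simp
    ultimately show False by linarith
  qed
  moreover have "card (r ` {..<N - ?d}) = card ({..<N} - legs D)"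
    using legs_less[OF D N] by (simp add: card_image inj card_Diff_subset card_legs[OF D])
  ultimately have eq: "r ` {..<N - ?d} = {..<N} - legs D"
    by (intro card_subset_eq) auto
  have "sorted_list_of_set ({..<N} - legs D) = map r [0..<N - ?d]"
  proof (rule sorted_distinct_set_unique)
    have "sorted_wrt (<) (map r [0..<N - ?d])"
      using mono by (auto simp: sorted_wrt_iff_nth_less)
    then show "sorted (map r [0..<N - ?d])" "distinct (map r [0..<N - ?d])"
      by (auto simp: strict_sorted_iff)
  qed (use eq in \<open>auto simp: atLeast0LessThan\<close>)
  then show ?thesis using r[of "i - ?d"] i by simp
qed

section \<open>The Giambelli formula and the expansion\<close>

lemma det_transpose_fun:
  fixes A :: "nat \<Rightarrow> nat \<Rightarrow> 'a :: comm_ring_1"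
  shows "det (mat n n (\<lambda>(i, j). A j i)) = det (mat n n (\<lambda>(i, j). A i j))"
proof -
  have "mat n n (\<lambda>(i, j). A j i) = transpose_mat (mat n n (\<lambda>(i, j). A i j))"
    by (rule eq_matI) auto
  then show ?thesis by (simp only: det_transpose[of "mat n n (\<lambda>(i, j). A i j)" n] mat_carrier)
qed

lemma det_scale:
  fixes A :: "nat \<Rightarrow> nat \<Rightarrow> 'a :: comm_ring_1"
  shows "det (mat n n (\<lambda>(i, j). u i * v j * A i j))
     = (\<Prod>i<n. u i) * (\<Prod>j<n. v j) * det (mat n n (\<lambda>(i, j). A i j))"
proof -
  have "(\<Prod>i=0..<n. u i * v (p i) * A i (p i)) = (\<Prod>i<n. u i) * (\<Prod>j<n. v j) * (\<Prod>i=0..<n. A i (p i))"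
    if "p permutes {0..<n}" for p
    using prod.permute[OF that, of v] by (simp add: prod.distrib atLeast0LessThan o_def)
  then show ?thesis
    using det_def'[of "mat n n (\<lambda>(i, j). u i * v j * A i j)" n] det_def'[of "mat n n (\<lambda>(i, j). A i j)" n]
    by (simp add: permutes_less sum_distrib_left mult_ac cong: sum.cong_simp prod.cong_simp)
qed

lemma det_upper_triangular_fun:
  fixes A :: "nat \<Rightarrow> nat \<Rightarrow> 'a :: comm_ring_1"
  assumes "\<And>i j. j < i \<Longrightarrow> i < n \<Longrightarrow> A i j = 0"
  shows "det (mat n n (\<lambda>(i, j). A i j)) = (\<Prod>i<n. A i i)"
  by (subst det_upper_triangular[of _ n])
    (use assms in \<open>auto simp: upper_triangular_def prod_list_diag_prod atLeast0LessThan\<close>)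

lemma multi_schur_eq_det_jt_entry:
  assumes "young_diagram D" "num_rows D \<le> N"
  shows "multi_schur a D = det (mat N N (\<lambda>(i, j). jt_entry a (bead D i) j))"
  unfolding schur_det_eq_multi_schur[OF assms, symmetric] schur_det_def
  by (simp only: jt_entry_h_multi bead_def)

definition leg_sign :: "nat set \<Rightarrow> 'a :: comm_ring_1" where
  "leg_sign Q = (\<Prod>q\<in>Q. (-1) ^ q)"

lemma leg_sign_square: "leg_sign Q * leg_sign Q = 1"
  by (simp add: leg_sign_def prod.distrib[symmetric] power_mult_distrib[symmetric])

lemma leg_sign_desc: "finite Q \<Longrightarrow> (\<Prod>i<card Q. (-1) ^ desc Q i) = leg_sign Q"
  unfolding leg_sign_def using prod.reindex_bij_betw[OF desc_bij_betw[of Q], of "\<lambda>q. (-1) ^ q"]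
  by (simp add: atLeast0LessThan)

text \<open>
  Written in terms of the rows of the empty diagram, the Jacobi--Trudi matrix has rows of hook
  functions, for the beads \<open>p\<^sub>i\<close>, followed by unit rows for the negative beads, which avoid exactly
  the columns \<open>q\<^sub>j\<close>. The change of rows has determinant \<open>1\<close>.
\<close>

lemma giambelli:
  assumes D: "young_diagram D"
  shows "multi_schur a D = leg_sign (legs D) *
    det (mat (diag_size D) (diag_size D) (\<lambda>(i, j). hook_fun a (desc (arms D) i) (desc (legs D) j)))"
proof -
  define N where "N = num_rows D"
  let ?d = "diag_size D"
  let ?r = "sorted_list_of_set ({..<N} - legs D)"
  define W where "W = (\<lambda>i k. if i < ?d then hook_fun a (desc (arms D) i) k
     else if k = ?r ! (i - ?d) then 1 else 0)"
  let ?T = "\<lambda>k j. jt_entry a (- 1 - int k) j"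
  have legs: "legs D \<subseteq> {..<N}" using legs_less[OF D] by (simp add: N_def)
  have len: "length ?r = N - ?d"
    using legs by (simp add: card_Diff_subset card_legs[OF D])
  have entry: "(\<Sum>k<N. W i k * ?T k j) = jt_entry a (bead D i) j" if ij: "i < N" "j < N" for i j
  proof (cases "i < ?d")
    case True
    obtain N' where N': "N = Suc N'" using ij by (cases N) auto
    then show ?thesis
      using True ij hook_fun_sum[of j N' a "desc (arms D) i"]
      by (simp add: W_def lessThan_Suc_atMost desc_arms[OF D] bead_frob_p[OF D])
  next
    case False
    have "?r ! (i - ?d) \<in> set ?r" using False ij len by (intro nth_mem) simp
    then have "?r ! (i - ?d) < N" by simp
    then have "(\<Sum>k<N. W i k * ?T k j) = ?T (?r ! (i - ?d)) j"
      using False by (simp add: W_def if_distrib[of "\<lambda>x. x * _"] cong: if_cong)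
    then show ?thesis
      using bead_negative[OF D, of N i] False ij by (simp add: N_def)
  qed
  have "multi_schur a D = det (mat N N (\<lambda>(i, j). jt_entry a (bead D i) j))"
    by (rule multi_schur_eq_det_jt_entry[OF D]) (simp add: N_def)
  also have "mat N N (\<lambda>(i, j). jt_entry a (bead D i) j) = mat N N (\<lambda>(i, k). W i k) * mat N N (\<lambda>(k, j). ?T k j)"
    by (rule eq_matI) (simp_all add: scalar_prod_def entry[symmetric] atLeast0LessThan)
  also have "det \<dots> = det (mat N N (\<lambda>(i, k). W i k)) * det (mat N N (\<lambda>(k, j). ?T k j))"
    by (rule det_mult[of _ N]) auto
  also have "det (mat N N (\<lambda>(k, j). ?T k j)) = 1"
    by (subst det_upper_triangular_fun) (simp_all add: jt_entry_above)
  also have "det (mat N N (\<lambda>(i, k). W i k)) = leg_sign (legs D) *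
      det (mat ?d ?d (\<lambda>(i, j). hook_fun a (desc (arms D) i) (desc (legs D) j)))"
    using det_unit_rows[OF legs, of "\<lambda>i. hook_fun a (desc (arms D) i)"]
    by (simp only: W_def card_legs[OF D] leg_sign_def)
  finally show ?thesis by simp
qed

definition frob_det :: "(int \<Rightarrow> complex) \<Rightarrow> (int \<Rightarrow> complex) \<Rightarrow> nat set \<Rightarrow> nat set \<Rightarrow> complex" where
  "frob_det a b P P' = det (mat (card P) (card P) (\<lambda>(i, j). hook_coeff a b (desc P i) (desc P' j)))"

text \<open>
  Passing from reflected to hatted sequences moves the sign of the Giambelli formula from one
  diagram to the other.
\<close>

lemma frob_det_hat:
  assumes "finite Q" "finite Q'" "card Q' = card Q"
  shows "leg_sign Q * frob_det (reflect a) (reflect b) Q Q' = leg_sign Q' * frob_det (hat a) (hat b) Q Q'"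
proof -
  have "frob_det (hat a) (hat b) Q Q' = leg_sign Q * leg_sign Q' * frob_det (reflect a) (reflect b) Q Q'"
    using det_scale[of "card Q" "\<lambda>i. (-1) ^ desc Q i" "\<lambda>j. (-1) ^ desc Q' j"
        "\<lambda>i j. hook_coeff (reflect a) (reflect b) (desc Q i) (desc Q' j)"]
      leg_sign_desc[OF assms(1), where 'a = complex] leg_sign_desc[OF assms(2), where 'a = complex]
    by (simp add: frob_det_def hook_coeff_hat power_add assms(3))
  then have "leg_sign Q' * frob_det (hat a) (hat b) Q Q'
      = (leg_sign Q' * leg_sign Q') * (leg_sign Q * frob_det (reflect a) (reflect b) Q Q')"
    by (simp only: mult_ac)
  then show ?thesis by (simp add: leg_sign_square)
qed

lemma frob_det_same: "frob_det a b P P = 1"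
  unfolding frob_det_def
  by (subst det_upper_triangular_fun) (simp_all add: hook_coeff_above hook_coeff_same desc_strict_antimono)

lemma desc_antimono: "i \<le> j \<Longrightarrow> j < card P \<Longrightarrow> desc P j \<le> desc P i"
  using desc_strict_antimono[of i j P] by (cases "i = j") auto

text \<open>
  If \<open>p\<^sub>r < p'\<^sub>r\<close>, then \<open>p\<^sub>i < p'\<^sub>k\<close> for all \<open>k \<le> r \<le> i\<close>, which is a block of zeros too large
  for a nonzero determinant.
\<close>

lemma frob_det_nonzeroD:
  assumes "frob_det a b P P' \<noteq> 0" "card P' = card P" "r < card P"
  shows "desc P' r \<le> desc P r"
proof (rule ccontr)
  assume *: "\<not> desc P' r \<le> desc P r"
  have "det (mat (card P) (card P) (\<lambda>(k, i). hook_coeff a b (desc P i) (desc P' k))) = 0"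
  proof (rule det_zero_block[OF assms(3)])
    fix k i assume "k \<le> r" "r \<le> i" "i < card P"
    then have "desc P i \<le> desc P r" "desc P' r \<le> desc P' k"
      using assms by (simp_all add: desc_antimono)
    then show "hook_coeff a b (desc P i) (desc P' k) = 0"
      using * by (intro hook_coeff_above) simp
  qed
  then have "frob_det a b P P' = 0"
    unfolding frob_det_def by (rule det_transpose_fun[symmetric, THEN trans])
  with assms(1) show False by simp
qed

lemma scalar_det:
  "det (mat d d (\<lambda>(i, j). scalar (A i j))) = scalar (det (mat d d (\<lambda>(i, j). A i j)))"
proof -
  have "mat d d (\<lambda>(i, j). scalar (A i j)) = map_mat scalar (mat d d (\<lambda>(i, j). A i j))"
    by (rule eq_matI) auto
  then show ?thesis by (simp only: scalar.hom_det)
qed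

text \<open>
  The transition of the hook functions is a product of three matrices. The Cauchy--Binet formula
  is applied to the first product for the rows and then, inside each term, to the second one for
  the columns.
\<close>

lemma hook_det_expansion:
  assumes P: "P \<subseteq> {..<m}" "card P = d" and Q: "Q \<subseteq> {..<m}" "card Q = d"
  shows "det (mat d d (\<lambda>(i, j). hook_fun a (desc P i) (desc Q j))) =
    (\<Sum>P' | P' \<subseteq> {..<m} \<and> card P' = d. \<Sum>Q' | Q' \<subseteq> {..<m} \<and> card Q' = d.
       scalar (frob_det a b P P') * scalar (frob_det (reflect a) (reflect b) Q Q') *
       det (mat d d (\<lambda>(i, j). hook_fun b (desc P' i) (desc Q' j))))"
proof -
  let ?C = "\<lambda>p p'. scalar (hook_coeff a b p p')"
  let ?K = "\<lambda>q q'. scalar (hook_coeff (reflect a) (reflect b) q q')"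
  let ?S = "{P. P \<subseteq> {..<m} \<and> card P = d}"
  have fin: "finite P" "finite Q" using P Q finite_subset by blast+
  have less: "desc P i < m" "desc Q i < m" if "i < d" for i
    using desc_in[OF fin(1), of i] desc_in[OF fin(2), of i] that P Q by auto
  have trans: "hook_fun a p q = (\<Sum>p'<m. ?C p p' * (\<Sum>k<m. hook_fun b p' k * ?K q k))"
    if "p < m" "q < m" for p q
  proof -
    have "hook_fun a p q = (\<Sum>p'\<le>p. ?C p p' * (\<Sum>k\<le>q. hook_fun b p' k * ?K q k))"
      by (simp only: hook_fun_transition[of a p q b] sum_distrib_left mult.assoc)
    also have "\<dots> = (\<Sum>p'<m. ?C p p' * (\<Sum>k\<le>q. hook_fun b p' k * ?K q k))"
      by (rule sum.mono_neutral_left) (use that in \<open>auto simp: hook_coeff_above\<close>)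
    also have "\<dots> = (\<Sum>p'<m. ?C p p' * (\<Sum>k<m. hook_fun b p' k * ?K q k))"
      by (intro sum.cong refl arg_cong2[where f = "(*)"] sum.mono_neutral_left)
        (use that in \<open>auto simp: hook_coeff_above\<close>)
    finally show ?thesis .
  qed
  have transposed: "det (mat d d (\<lambda>(i, j). ?K (desc Q j) (desc Q' i)))
      = scalar (frob_det (reflect a) (reflect b) Q Q')" for Q'
    unfolding frob_det_def Q scalar_det[symmetric] by (rule det_transpose_fun)
  have "det (mat d d (\<lambda>(i, j). hook_fun a (desc P i) (desc Q j)))
     = det (mat d d (\<lambda>(i, j). \<Sum>p'<m. ?C (desc P i) p' * (\<Sum>k<m. hook_fun b p' k * ?K (desc Q j) k)))"
    by (intro arg_cong[where f = det] eq_matI) (simp_all add: trans less)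
  also have "\<dots> = (\<Sum>P'\<in>?S. det (mat d d (\<lambda>(i, j). ?C (desc P i) (desc P' j))) *
      det (mat d d (\<lambda>(i, j). \<Sum>k<m. hook_fun b (desc P' i) k * ?K (desc Q j) k)))"
    by (rule cauchy_binet)
  also have "\<dots> = (\<Sum>P'\<in>?S. scalar (frob_det a b P P') *
      (\<Sum>Q'\<in>?S. det (mat d d (\<lambda>(i, j). hook_fun b (desc P' i) (desc Q' j))) *
         det (mat d d (\<lambda>(i, j). ?K (desc Q j) (desc Q' i)))))"
    by (simp only: cauchy_binet[where B = "\<lambda>k j. ?K (desc Q j) k"] scalar_det frob_det_def P)
  also have "\<dots> = (\<Sum>P'\<in>?S. \<Sum>Q'\<in>?S.
       scalar (frob_det a b P P') * scalar (frob_det (reflect a) (reflect b) Q Q') *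
       det (mat d d (\<lambda>(i, j). hook_fun b (desc P' i) (desc Q' j))))"
    by (simp only: transposed sum_distrib_left mult_ac)
  finally show ?thesis .
qed

text \<open>
  The determinants only compare diagrams with the same number of diagonal squares; for all other
  sets the coefficient is zero.
\<close>

definition frob_coeff ::
  "(int \<Rightarrow> complex) \<Rightarrow> (int \<Rightarrow> complex) \<Rightarrow> (nat \<times> nat) set \<Rightarrow> (nat \<times> nat) set \<Rightarrow> complex" where
  "frob_coeff a b D E = (if young_diagram E \<and> diag_size E = diag_size D
     then frob_det a b (arms D) (arms E) * frob_det (hat a) (hat b) (legs D) (legs E) else 0)"

lemma frob_coeff_nonzeroD:
  assumes D: "young_diagram D" and "frob_coeff a b D E \<noteq> 0"
  shows "young_diagram E" "diag_size E = diag_size D" "E \<subseteq> D"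
proof -
  from assms(2) show E: "young_diagram E" and d: "diag_size E = diag_size D"
    by (auto simp: frob_coeff_def split: if_splits)
  from assms(2) have nz: "frob_det a b (arms D) (arms E) \<noteq> 0" "frob_det (hat a) (hat b) (legs D) (legs E) \<noteq> 0"
    by (auto simp: frob_coeff_def split: if_splits)
  show "E \<subseteq> D"
  proof (rule diagram_subset_if_frobenius_le[OF D E d])
    fix i assume "i < diag_size D"
    then show "frob_p E (Suc i) \<le> frob_p D (Suc i)" "frob_q E (Suc i) \<le> frob_q D (Suc i)"
      using frob_det_nonzeroD[OF nz(1), of i] frob_det_nonzeroD[OF nz(2), of i] D E d
      by (simp_all add: card_arms card_legs desc_arms desc_legs)
  qed
qed

lemma frob_coeff_same: "young_diagram D \<Longrightarrow> frob_coeff a b D D = 1"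
  by (simp add: frob_coeff_def frob_det_same)

lemma scalar_leg_sign: "scalar (leg_sign Q) = leg_sign Q"
  by (simp add: leg_sign_def scalar.hom_prod scalar.hom_power scalar.hom_uminus)

text \<open>
  The pairs of \<open>d\<close>-element sets produced by the two Cauchy--Binet expansions are the pairs of arms
  and legs of the diagrams with \<open>d\<close> diagonal squares. The bound \<open>m\<close> only serves to make the
  index sets finite; diagrams outside it have coefficient zero.
\<close>

lemma schur_expansion_frob_coeff:
  assumes D: "young_diagram D"
  shows "schur_expansion a b D (frob_coeff a b D)"
proof -
  let ?d = "diag_size D"
  let ?supp = "{E. frob_coeff a b D E \<noteq> 0}"
  have "?supp \<subseteq> Pow D" using frob_coeff_nonzeroD(3)[OF D] by blast
  then have fin: "finite ?supp" by (rule finite_subset) (use young_diagramD(1)[OF D] in simp)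
  define m where "m = Suc (Max (insert 0 (arms D \<union> legs D \<union> \<Union> (arms ` ?supp) \<union> \<Union> (legs ` ?supp))))"
  have "x < m" if "x \<in> arms D \<union> legs D \<union> \<Union> (arms ` ?supp) \<union> \<Union> (legs ` ?supp)" for x
    unfolding m_def less_Suc_eq_le by (rule Max_ge) (use that fin in auto)
  then have less: "arms D \<subseteq> {..<m}" "legs D \<subseteq> {..<m}"
    and less_supp: "\<And>E. E \<in> ?supp \<Longrightarrow> arms E \<subseteq> {..<m} \<and> legs E \<subseteq> {..<m}"
    by blast+
  let ?S = "{P. P \<subseteq> {..<m} \<and> card P = ?d}"
  let ?V = "{E. young_diagram E \<and> diag_size E = ?d \<and> arms E \<subseteq> {..<m} \<and> legs E \<subseteq> {..<m}}"
  let ?g = "\<lambda>(P', Q'). scalar (frob_det a b (arms D) P') * scalar (frob_det (hat a) (hat b) (legs D) Q') *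
       (leg_sign Q' * det (mat ?d ?d (\<lambda>(i, j). hook_fun b (desc P' i) (desc Q' j))))"
  have finS: "finite P" if "P \<in> ?S" for P using that finite_subset by blast
  \<comment> \<open>The sign in the Giambelli formula for \<open>a\<close> becomes the sign in that for \<open>b\<close>.\<close>
  have sign: "leg_sign (legs D) * scalar (frob_det (reflect a) (reflect b) (legs D) Q')
      = leg_sign Q' * scalar (frob_det (hat a) (hat b) (legs D) Q')" if "Q' \<in> ?S" for Q'
    using arg_cong[OF frob_det_hat[of "legs D" Q' a b], of scalar] that finS[OF that] card_legs[OF D]
    by (simp add: scalar_mult scalar_leg_sign)
  have "multi_schur a D = leg_sign (legs D) *
     (\<Sum>P'\<in>?S. \<Sum>Q'\<in>?S. scalar (frob_det a b (arms D) P') * scalar (frob_det (reflect a) (reflect b) (legs D) Q') *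
       det (mat ?d ?d (\<lambda>(i, j). hook_fun b (desc P' i) (desc Q' j))))"
    by (simp only: giambelli[OF D] hook_det_expansion[OF less(1) card_arms[OF D] less(2) card_legs[OF D], of a b])
  also have "\<dots> = (\<Sum>P'\<in>?S. \<Sum>Q'\<in>?S. scalar (frob_det a b (arms D) P') *
      (leg_sign (legs D) * scalar (frob_det (reflect a) (reflect b) (legs D) Q')) *
       det (mat ?d ?d (\<lambda>(i, j). hook_fun b (desc P' i) (desc Q' j))))"
    by (simp only: sum_distrib_left mult_ac)
  also have "\<dots> = (\<Sum>P'\<in>?S. \<Sum>Q'\<in>?S. ?g (P', Q'))"
    by (intro sum.cong refl) (simp add: sign mult_ac)
  also have "\<dots> = (\<Sum>x\<in>?S \<times> ?S. ?g x)"
    by (simp only: sum.cartesian_product) (rule sum.cong; auto)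
  also have "\<dots> = (\<Sum>E\<in>?V. scalar (frob_coeff a b D E) * multi_schur b E)"
  proof (rule sum.reindex_bij_witness[of _ "\<lambda>E. (arms E, legs E)" "\<lambda>(P, Q). diagram_of P Q"])
    fix x assume "x \<in> ?S \<times> ?S"
    then obtain P Q where x: "x = (P, Q)" and PQ: "P \<in> ?S" "Q \<in> ?S" by blast
    note fin = finS[OF PQ(1)] finS[OF PQ(2)]
    have card: "card P = card Q" using PQ by simp
    note facts = young_diagram_diagram_of[OF fin card] arms_diagram_of[OF fin card] legs_diagram_of[OF fin card]
      diag_size_diagram_of[OF card]
    show "(case case x of (P, Q) \<Rightarrow> diagram_of P Q of E \<Rightarrow> (arms E, legs E)) = x"
      by (simp add: x facts)
    show "(case x of (P, Q) \<Rightarrow> diagram_of P Q) \<in> ?V"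
      using PQ by (simp add: x facts)
    show "scalar (frob_coeff a b D (case x of (P, Q) \<Rightarrow> diagram_of P Q)) *
        multi_schur b (case x of (P, Q) \<Rightarrow> diagram_of P Q) = ?g x"
      using PQ by (simp add: x facts giambelli frob_coeff_def scalar_mult)
  next
    fix E assume "E \<in> ?V"
    then show "(case (arms E, legs E) of (P, Q) \<Rightarrow> diagram_of P Q) = E" "(arms E, legs E) \<in> ?S \<times> ?S"
      by (simp_all add: diagram_of_frobenius card_arms card_legs)
  qed
  also have "\<dots> = (\<Sum>E\<in>?supp. scalar (frob_coeff a b D E) * multi_schur b E)"
  proof (rule sum.mono_neutral_right)
    have "?V \<subseteq> (\<lambda>(P, Q). diagram_of P Q) ` (Pow {..<m} \<times> Pow {..<m})"
      by (auto intro!: image_eqI[of _ _ "(arms _, legs _)"] simp: diagram_of_frobenius)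
    then show "finite ?V" by (rule finite_subset) simp
    show "?supp \<subseteq> ?V" using frob_coeff_nonzeroD[OF D] less_supp by blast
  qed auto
  finally show ?thesis
    unfolding schur_expansion_def using fin frob_coeff_nonzeroD(1)[OF D] by auto
qed

section \<open>Specialisations of symmetric functions\<close>

definition monom_value :: "(nat \<Rightarrow> complex) \<Rightarrow> (nat \<Rightarrow>\<^sub>0 nat) \<Rightarrow> complex" where
  "monom_value x m = (\<Prod>i\<in>Poly_Mapping.keys m. x i ^ Poly_Mapping.lookup m i)"

definition specialise :: "(nat \<Rightarrow> complex) \<Rightarrow> symfun \<Rightarrow> complex" where
  "specialise x f = (\<Sum>m\<in>Poly_Mapping.keys f. Poly_Mapping.lookup f m * monom_value x m)"

lemma monom_value_superset: "finite S \<Longrightarrow> Poly_Mapping.keys m \<subseteq> S \<Longrightarrow> monom_value x m = (\<Prod>i\<in>S. x i ^ Poly_Mapping.lookup m i)"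
  unfolding monom_value_def by (rule prod.mono_neutral_left) (auto simp: in_keys_iff)

lemma monom_value_add: "monom_value x (m + n) = monom_value x m * monom_value x n"
proof -
  let ?S = "Poly_Mapping.keys m \<union> Poly_Mapping.keys n"
  have "monom_value x (m + n) = (\<Prod>i\<in>?S. x i ^ Poly_Mapping.lookup (m + n) i)"
    by (rule monom_value_superset) (use keys_add[of m n] in auto)
  then show ?thesis
    by (simp add: lookup_add power_add prod.distrib monom_value_superset[of ?S, symmetric])
qed

lemma specialise_superset:
  "finite S \<Longrightarrow> Poly_Mapping.keys f \<subseteq> S \<Longrightarrow> specialise x f = (\<Sum>m\<in>S. Poly_Mapping.lookup f m * monom_value x m)"
  unfolding specialise_def by (rule sum.mono_neutral_left) (auto simp: in_keys_iff)

lemma specialise_add: "specialise x (f + g) = specialise x f + specialise x g"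
proof -
  let ?S = "Poly_Mapping.keys f \<union> Poly_Mapping.keys g"
  have "specialise x (f + g) = (\<Sum>m\<in>?S. Poly_Mapping.lookup (f + g) m * monom_value x m)"
    by (rule specialise_superset) (use keys_add[of f g] in auto)
  then show ?thesis
    by (simp add: lookup_add distrib_right sum.distrib specialise_superset[of ?S, symmetric])
qed

lemma specialise_0 [simp]: "specialise x 0 = 0"
  by (simp add: specialise_def)

lemma specialise_sum: "specialise x (\<Sum>i\<in>S. f i) = (\<Sum>i\<in>S. specialise x (f i))"
  by (induction S rule: infinite_finite_induct) (simp_all add: specialise_add)

lemma specialise_single: "specialise x (Poly_Mapping.single m c) = c * monom_value x m"
  by (simp add: specialise_def)

lemma sum_singles: "f = (\<Sum>m\<in>Poly_Mapping.keys f. Poly_Mapping.single m (Poly_Mapping.lookup f m))"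
  by (rule poly_mapping_eqI) (simp add: lookup_sum lookup_single when_def in_keys_iff)

lemma specialise_mult: "specialise x (f * g) = specialise x f * specialise x g"
proof -
  have "f * g = (\<Sum>m\<in>Poly_Mapping.keys f. Poly_Mapping.single m (Poly_Mapping.lookup f m)) * (\<Sum>n\<in>Poly_Mapping.keys g. Poly_Mapping.single n (Poly_Mapping.lookup g n))"
    by (simp only: sum_singles[symmetric])
  also have "specialise x \<dots> = (\<Sum>m\<in>Poly_Mapping.keys f. \<Sum>n\<in>Poly_Mapping.keys g. (Poly_Mapping.lookup f m * monom_value x m) * (Poly_Mapping.lookup g n * monom_value x n))"
    by (simp add: sum_product specialise_sum mult_single specialise_single monom_value_add mult_ac)
  finally show ?thesis by (simp add: specialise_def sum_product)
qed

lemma specialise_scalar [simp]: "specialise x (scalar c) = c"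
  by (simp add: scalar_def specialise_single monom_value_def)

interpretation specialise: comm_ring_hom "specialise x" for x
  using specialise_scalar[of x 1] by unfold_locales (simp_all add: specialise_mult specialise_add)

lemma specialise_H_series:
  assumes "fps_nth L 0 = 0"
  shows "specialise (\<lambda>k. of_nat (Suc k) * fps_nth L (Suc k)) (fps_nth H_series n) = fps_nth (fps_exp 1 oo L) n"
proof -
  let ?x = "\<lambda>k. of_nat (Suc k) * fps_nth L (Suc k)"
  let ?B = "Abs_fps (\<lambda>k. if k = 0 then 0 else scalar (1 / of_nat k) * powersum k)"
  have B: "specialise ?x (fps_nth ?B k) = fps_nth L k" for k
  proof (cases k)
    case (Suc k')
    have "specialise ?x (powersum k) = ?x k'"
      by (simp add: powersum_def Suc specialise_single monom_value_def)
    then show ?thesis by (simp add: Suc specialise_mult del: of_nat_Suc)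
  qed (simp add: assms)
  have "specialise ?x (fps_nth (?B ^ i) n) = fps_nth (L ^ i) n" for i n
  proof (induction i arbitrary: n)
    case (Suc i)
    then show ?case by (simp only: power_Suc fps_mult_nth specialise_sum specialise_mult B)
  qed (simp add: specialise.hom_one)
  then show ?thesis
    by (simp only: H_series_def fps_compose_nth specialise_sum specialise_mult fps_nth_Abs_fps
        specialise_scalar) simp
qed

text \<open>
  The power sums are free, and \<open>H\<close> is the exponential of their generating series; so the
  logarithm of \<open>\<eta>\<close> tells which values to give to them.
\<close>

lemma ex_specialisation:
  assumes "fps_nth \<eta> 0 = 1"
  obtains x where "\<And>n. specialise x (fps_nth H_series n) = fps_nth \<eta> n"
proof -
  define L where "L = fps_ln 1 oo (\<eta> - 1)"
  have e0: "fps_nth (\<eta> - 1) 0 = 0" by (simp add: assms)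
  have L0: "fps_nth L 0 = 0" by (simp add: L_def)
  have inv: "(fps_exp 1 - 1) oo fps_ln 1 = (fps_X :: complex fps)"
    using fps_inv_right[of "fps_exp 1 - 1 :: complex fps"] fps_ln_fps_exp_inv[of "1::complex"] by simp
  have "(fps_exp 1 - 1) oo L = ((fps_exp 1 - 1) oo fps_ln 1) oo (\<eta> - 1)"
    unfolding L_def by (rule fps_compose_assoc) (simp_all add: assms)
  also have "\<dots> = \<eta> - 1"
    by (simp add: inv fps_X_fps_compose_startby0 assms)
  finally have "fps_exp 1 oo L = \<eta>"
    by (simp add: fps_compose_sub_distrib)
  then show ?thesis
    using that specialise_H_series[OF L0] by metis
qed

lemma specialise_H_residue:
  assumes x: "\<And>n. specialise x (fps_nth H_series n) = fps_nth \<eta> n" and \<eta>: "fps_nth \<eta> 0 = 1"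
  shows "specialise x (H_residue F) = res (F * fps_to_fls \<eta>)"
proof -
  have "specialise x (H_residue F)
      = (\<Sum>k | fls_nth F (1 - int k) \<noteq> 0. fls_nth F (1 - int k) * fps_nth \<eta> k)"
    by (simp add: H_residue_def specialise_sum specialise_mult x)
  also have "\<dots> = (\<Sum>i | fls_nth F i \<noteq> 0 \<and> i \<le> 1. fls_nth F i * fps_nth \<eta> (nat (1 - i)))"
    by (rule sum.reindex_bij_witness[of _ "\<lambda>i. nat (1 - i)" "\<lambda>k. 1 - int k"]) auto
  also have "\<dots> = (\<Sum>i = fls_subdegree F..1. fls_nth F i * fps_nth \<eta> (nat (1 - i)))"
    by (rule sum.mono_neutral_left) (auto simp: not_less[symmetric])
  also have "\<dots> = (\<Sum>i = fls_subdegree F..1 - fls_subdegree (fps_to_fls \<eta>). fls_nth F i * fls_nth (fps_to_fls \<eta>) (1 - i))"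
  proof -
    have "subdegree \<eta> = 0" using \<eta> by (simp add: subdegree_eq_0_iff)
    then show ?thesis by (intro sum.cong) (simp_all add: fls_subdegree_fls_to_fps)
  qed
  also have "\<dots> = res (F * fps_to_fls \<eta>)"
    by (rule fls_times_nth(2)[symmetric])
  finally show ?thesis .
qed

section \<open>Linear independence\<close>

text \<open>
  The residue of \<open>P(u) / (u - z)\<close> is \<open>P(z)\<close>; for a product of linear factors this follows by
  writing each factor as \<open>(u - z) + (z - f\<^sub>i)\<close>.
\<close>

lemma res_prod_factor_divide:
  assumes "finite S"
  shows "res ((\<Prod>i\<in>S. factor (f i)) / factor z) = (\<Prod>i\<in>S. z - f i)"
  using assms
proof (induction S rule: finite_induct)
  case empty
  have "gen_power (\<lambda>_. z) 1 = factor z" by (simp add: gen_power_def)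
  then show ?case
    using gen_power_top[of "\<lambda>_. z" "- 1"] gen_power_reflect[of "\<lambda>_. z" "- 1"] by simp
next
  case (insert l S)
  let ?Q = "(\<Prod>i\<in>S. factor (f i)) / factor z"
  have "factor (f l) = factor z + fls_const (z - f l)"
    by (rule fls_eqI) (simp add: factor_nth)
  then have "factor (f l) * ?Q = (\<Prod>i\<in>S. factor (f i)) + fls_const (z - f l) * ?Q"
    by (simp add: distrib_right add_divide_distrib)
  then have "res (factor (f l) * ?Q) = (z - f l) * res ?Q"
    using res_poly_in_u[OF poly_in_u_prod[OF insert(1), of f]]
    by (simp only: fls_plus_nth fls_mult_const_nth add_0)
  then show ?case using insert by simp
qed

text \<open>
  Let \<open>H(u)\<close> become the quotient of \<open>\<Prod>(u - b\<^sub>1\<^sub>-\<^sub>i)\<close> by \<open>\<Prod>(u - z\<^sub>k)\<close>, where \<open>i\<close> and \<open>k\<close> run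
  from \<open>1\<close> to \<open>N\<close> and \<open>z\<^sub>k\<close> is the parameter with index \<open>\<lambda>\<^sub>k - k + 1\<close>. Combine the columns of
  the Jacobi--Trudi matrix so that the column factors become the products of all \<open>u - z\<^sub>l\<close> with
  \<open>l \<noteq> k\<close>. By the residue formula the entry in row \<open>i\<close> and column \<open>k\<close> becomes the product of
  \<open>z\<^sub>k - b\<^sub>l\<close> over \<open>1 - N \<le> l \<le> \<nu>\<^sub>i - i\<close>. For distinct parameters it is zero exactly if
  \<open>\<lambda>\<^sub>k - k < \<nu>\<^sub>i - i\<close>. Thus the matrix is triangular with nonzero diagonal for \<open>\<nu> = \<lambda>\<close>, and it
  contains a large block of zeros if some row of \<open>\<nu>\<close> is longer than that of \<open>\<lambda>\<close>.
\<close>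

lemma vanishing_specialisation:
  assumes E: "young_diagram E" and N: "num_rows E \<le> N"
  obtains x where
    "\<And>D. young_diagram D \<Longrightarrow> num_rows D \<le> N \<Longrightarrow> \<not> D \<subseteq> E \<Longrightarrow> specialise x (multi_schur of_int D) = 0"
    "specialise x (multi_schur of_int E) \<noteq> 0"
proof -
  define \<beta> :: "int \<Rightarrow> complex" where "\<beta> = of_int"
  define z where "z k = \<beta> (bead E k + 1)" for k
  let ?Z = "\<Prod>k\<in>{..<N}. factor (z k)"
  have Z0: "?Z \<noteq> 0" by simp
  let ?f = "(1 / gen_power \<beta> (- int N)) / ?Z"
  have sub: "fls_subdegree ?f = 0"
    by (simp add: fls_divide_subdegree gen_power_subdegree fls_subdegree_prod factor_subdegree)
  have top: "fls_nth ?f 0 = 1"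
  proof -
    have "deg_le ?f 0" using sub by (simp add: deg_le_iff)
    from top_coeff_mult[OF this prod_factor_top(1)[of "{..<N}" z]]
    have "fls_nth (1 / gen_power \<beta> (- int N)) (- int N) = fls_nth ?f 0"
      using prod_factor_top(2)[of "{..<N}" z] Z0 by simp
    then show ?thesis using gen_power_top[of "reflect \<beta>" "int N"] by (simp add: gen_power_reflect)
  qed
  \<comment> \<open>The quotient has degree zero and leading coefficient one, so it is a value that \<open>H\<close> can take.\<close>
  define \<eta> where "\<eta> = fls_regpart ?f"
  have \<eta>: "fps_to_fls \<eta> = ?f" "fps_nth \<eta> 0 = 1"
    using sub top by (simp_all add: \<eta>_def)
  obtain x where x: "\<And>n. specialise x (fps_nth H_series n) = fps_nth \<eta> n"
    using ex_specialisation[OF \<eta>(2)] by blast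
  define M where "M D i j = specialise x (jt_entry \<beta> (bead D i) j)" for D i j
  \<comment> \<open>\<open>Y\<close> contains the Newton coefficients of the new column factors in the old ones, \<open>1 / (u|\<beta>)\<^sup>-\<^sup>j\<close>.\<close>
  define g where "g k = (\<Prod>l\<in>{..<N} - {k}. factor (z l))" for k
  define Y where "Y j k = res (g k / gen_power (reflect \<beta>) (int j + 1))" for j k
  define W where "W D i k = (\<Prod>l\<in>{1 - int N..bead D i}. z k - \<beta> l)" for D i k
  have MY: "(\<Sum>j<N. M D i j * Y j k) = W D i k" if ik: "i < N" "k < N" for D i k
  proof -
    obtain N' where N': "N = Suc N'" using ik by (cases N) auto
    have card: "card ({..<N} - {k}) = N'" using ik N' by simp
    have "H_residue (g k * gen_power \<beta> (bead D i))
        = (\<Sum>j\<le>N'. scalar (Y j k) * H_residue (gen_power (reflect \<beta>) (int j) * gen_power \<beta> (bead D i)))"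
      unfolding Y_def g_def card[symmetric] by (rule prod_factor_expansion) simp
    then have "specialise x (H_residue (g k * gen_power \<beta> (bead D i))) = (\<Sum>j<N. M D i j * Y j k)"
      by (simp add: specialise_sum specialise_mult gen_power_reflect M_def jt_entry_def
          N' lessThan_Suc_atMost mult.commute)
    moreover have "specialise x (H_residue (g k * gen_power \<beta> (bead D i))) = W D i k"
    proof -
      have "?Z = factor (z k) * g k"
        unfolding g_def using ik by (intro prod.remove) auto
      moreover have "g k \<noteq> 0" by (simp add: g_def)
      ultimately have "g k * gen_power \<beta> (bead D i) * ?f
          = gen_power \<beta> (bead D i) / gen_power \<beta> (- int N) / factor (z k)"
        by (simp add: field_simps)
      moreover have "- int N \<le> bead D i" using ik by (simp add: bead_def)
      ultimately show ?thesis
        using gen_power_quotient[of "- int N" "bead D i" \<beta>]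
        by (simp add: specialise_H_residue[OF x \<eta>(2)] \<eta>(1) res_prod_factor_divide W_def add.commute)
    qed
    ultimately show ?thesis by simp
  qed
  have det: "specialise x (multi_schur \<beta> D) * det (mat N N (\<lambda>(j, k). Y j k)) = det (mat N N (\<lambda>(i, k). W D i k))"
    if "young_diagram D" "num_rows D \<le> N" for D
  proof -
    have "specialise x (multi_schur \<beta> D) = det (mat N N (\<lambda>(i, j). M D i j))"
      unfolding multi_schur_eq_det_jt_entry[OF that] specialise.hom_det[symmetric]
      by (intro arg_cong[where f = det] eq_matI) (simp_all add: M_def)
    moreover have "mat N N (\<lambda>(i, k). W D i k) = mat N N (\<lambda>(i, j). M D i j) * mat N N (\<lambda>(j, k). Y j k)"
      by (rule eq_matI) (simp_all add: scalar_prod_def MY[symmetric] atLeast0LessThan)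
    ultimately show ?thesis by (simp add: det_mult[of _ N])
  qed
  have W_eq_0_iff: "W D i k = 0 \<longleftrightarrow> bead E k < bead D i" if "k < N" for D i k
  proof -
    have "W D i k = of_int (\<Prod>l\<in>{1 - int N..bead D i}. bead E k + 1 - l)"
      by (simp add: W_def z_def \<beta>_def)
    then have "W D i k = 0 \<longleftrightarrow> (\<Prod>l\<in>{1 - int N..bead D i}. bead E k + 1 - l) = 0"
      by (simp only: of_int_eq_0_iff)
    also have "\<dots> \<longleftrightarrow> bead E k + 1 \<in> {1 - int N..bead D i}"
      by auto
    finally show ?thesis using that by (auto simp: bead_def)
  qed
  show ?thesis
  proof
    have "det (mat N N (\<lambda>(i, k). W E i k)) = det (mat N N (\<lambda>(k, i). W E i k))"
      by (rule det_transpose_fun[symmetric])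
    also have "\<dots> = (\<Prod>i<N. W E i i)"
      by (rule det_upper_triangular_fun) (simp add: W_eq_0_iff bead_strict_antimono[OF E])
    also have "\<dots> \<noteq> 0"
      by (simp add: W_eq_0_iff)
    finally have nz: "det (mat N N (\<lambda>(i, k). W E i k)) \<noteq> 0" .
    then show "specialise x (multi_schur of_int E) \<noteq> 0"
      using det[OF E N] by (auto simp: \<beta>_def)
    \<comment> \<open>The case of the diagram itself also shows that the change of columns is invertible.\<close>
    from nz have Y: "det (mat N N (\<lambda>(j, k). Y j k)) \<noteq> 0"
      using det[OF E N] by auto
    fix D assume D: "young_diagram D" "num_rows D \<le> N" "\<not> D \<subseteq> E"
    then obtain i j where ij: "(i, j) \<in> D" "(i, j) \<notin> E" by auto
    then have "1 \<le> i" "1 \<le> j" using young_diagramD(2)[OF D(1)] by auto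
    then obtain r where r: "i = Suc r" by (cases i) auto
    have row: "row_length E (Suc r) < row_length D (Suc r)"
      using ij mem_diagram_iff[OF D(1)] mem_diagram_iff[OF E] by (auto simp: r)
    have rN: "r < N"
      using num_rows_less_row_length_0[OF D(1), of "Suc r"] row D(2) by fastforce
    have "det (mat N N (\<lambda>(i, k). W D i k)) = 0"
    proof (rule det_zero_block[OF rN])
      fix i k assume ik: "i \<le> r" "r \<le> k" "k < N"
      have "bead E k \<le> bead E r" "bead D r \<le> bead D i"
        using row_length_antimono[OF E, of "Suc r" "Suc k"] row_length_antimono[OF D(1), of "Suc i" "Suc r"] ik
        by (simp_all add: bead_def)
      then show "W D i k = 0" using row ik by (simp add: W_eq_0_iff bead_def)
    qed
    then show "specialise x (multi_schur of_int D) = 0"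
      using det[OF D(1,2)] Y by (simp add: \<beta>_def)
  qed
qed

text \<open>
  In a linear relation, the specialisation attached to a smallest diagram that occurs leaves only
  the term of this diagram.
\<close>

lemma multi_schur_of_int_independent:
  assumes fin: "finite S" and young: "\<And>E. E \<in> S \<Longrightarrow> young_diagram E"
    and sum: "(\<Sum>E\<in>S. scalar (c E) * multi_schur of_int E) = 0"
    and E: "E \<in> S"
  shows "c E = 0"
proof (rule ccontr)
  let ?T = "{E \<in> S. c E \<noteq> 0}"
  assume "c E \<noteq> 0"
  then have "finite (card ` ?T)" "card ` ?T \<noteq> {}" using fin E by auto
  from Min_in[OF this] obtain F where F: "F \<in> ?T" "card F = Min (card ` ?T)" by auto
  have min: "card F \<le> card D" if "D \<in> ?T" for D
    unfolding F(2) by (rule Min_le) (use fin that in auto)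
  define N where "N = Max (num_rows ` S)"
  have N: "num_rows D \<le> N" if "D \<in> S" for D
    unfolding N_def by (rule Max_ge) (use fin that in auto)
  obtain x where x: "\<And>D. young_diagram D \<Longrightarrow> num_rows D \<le> N \<Longrightarrow> \<not> D \<subseteq> F \<Longrightarrow> specialise x (multi_schur of_int D) = 0"
    "specialise x (multi_schur of_int F) \<noteq> 0"
    using vanishing_specialisation[of F N] F(1) young N by blast
  have "(\<Sum>D\<in>S. c D * specialise x (multi_schur of_int D)) = specialise x (\<Sum>D\<in>S. scalar (c D) * multi_schur of_int D)"
    by (simp add: specialise_sum specialise_mult)
  then have "0 = (\<Sum>D\<in>S. c D * specialise x (multi_schur of_int D))"
    using sum by simp
  also have "\<dots> = (\<Sum>D\<in>{F}. c D * specialise x (multi_schur of_int D))"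
  proof (rule sum.mono_neutral_right)
    show "\<forall>D\<in>S - {F}. c D * specialise x (multi_schur of_int D) = 0"
    proof
      fix D assume D: "D \<in> S - {F}"
      show "c D * specialise x (multi_schur of_int D) = 0"
      proof (cases "c D = 0 \<or> \<not> D \<subseteq> F")
        case True
        then show ?thesis using x(1)[of D] young N D by auto
      next
        case False
        then have "D = F"
          using min[of D] D young F(1) by (intro card_subset_eq) (auto simp: young_diagramD(1) card_mono le_antisym)
        then show ?thesis using D by simp
      qed
    qed
  qed (use fin F in auto)
  finally show False using F(1) x(2) by simp
qed

text \<open>
  Expanding a relation into the functions with parameters \<open>b\<^sub>i = i\<close>, a largest diagram that occurs
  receives its coefficient from its own term only, by unitriangularity.
\<close>

lemma multi_schur_independent:
  assumes fin: "finite S" and young: "\<And>E. E \<in> S \<Longrightarrow> young_diagram E"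
    and sum: "(\<Sum>E\<in>S. scalar (c E) * multi_schur b E) = 0"
    and E: "E \<in> S"
  shows "c E = 0"
proof (rule ccontr)
  let ?T = "{E \<in> S. c E \<noteq> 0}"
  let ?C = "frob_coeff b of_int"
  assume "c E \<noteq> 0"
  then have "finite (card ` ?T)" "card ` ?T \<noteq> {}" using fin E by auto
  from Max_in[OF this] obtain F where F: "F \<in> ?T" "card F = Max (card ` ?T)" by auto
  have max: "card D \<le> card F" if "D \<in> ?T" for D
    unfolding F(2) by (rule Max_ge) (use fin that in auto)
  define U where "U = (\<Union>D\<in>S. {G. ?C D G \<noteq> 0})"
  have exp: "schur_expansion b of_int D (?C D)" if "D \<in> S" for D
    using schur_expansion_frob_coeff young that by blast
  have finU: "finite U" and youngU: "\<And>G. G \<in> U \<Longrightarrow> young_diagram G"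
    using exp fin unfolding U_def schur_expansion_def by blast+
  have expU: "multi_schur b D = (\<Sum>G\<in>U. scalar (?C D G) * multi_schur of_int G)" if "D \<in> S" for D
  proof -
    have "multi_schur b D = (\<Sum>G | ?C D G \<noteq> 0. scalar (?C D G) * multi_schur of_int G)"
      using exp[OF that] by (simp add: schur_expansion_def)
    also have "\<dots> = (\<Sum>G\<in>U. scalar (?C D G) * multi_schur of_int G)"
      by (rule sum.mono_neutral_left) (use finU that in \<open>auto simp: U_def\<close>)
    finally show ?thesis .
  qed
  have "(\<Sum>G\<in>U. scalar (\<Sum>D\<in>S. c D * ?C D G) * multi_schur of_int G)
      = (\<Sum>G\<in>U. \<Sum>D\<in>S. scalar (c D) * (scalar (?C D G) * multi_schur of_int G))"
    by (simp add: scalar.hom_sum scalar_mult sum_distrib_right mult.assoc)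
  also have "\<dots> = (\<Sum>D\<in>S. scalar (c D) * multi_schur b D)"
    by (subst sum.swap) (simp add: expU sum_distrib_left)
  finally have "(\<Sum>G\<in>U. scalar (\<Sum>D\<in>S. c D * ?C D G) * multi_schur of_int G) = 0"
    using sum by simp
  moreover have "F \<in> U"
    using F(1) frob_coeff_same[OF young, of F b of_int] by (force simp: U_def)
  ultimately have "(\<Sum>D\<in>S. c D * ?C D F) = 0"
    using multi_schur_of_int_independent[OF finU, of "\<lambda>G. \<Sum>D\<in>S. c D * ?C D G" F] youngU by blast
  moreover have "(\<Sum>D\<in>S. c D * ?C D F) = (\<Sum>D\<in>{F}. c D * ?C D F)"
  proof (rule sum.mono_neutral_right)
    show "\<forall>D\<in>S - {F}. c D * ?C D F = 0"
    proof
      fix D assume D: "D \<in> S - {F}"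
      show "c D * ?C D F = 0"
      proof (rule ccontr)
        assume nz: "c D * ?C D F \<noteq> 0"
        then have "F \<subseteq> D" using frob_coeff_nonzeroD(3)[of D b of_int F] young D by auto
        then have "F = D"
          using max[of D] D young nz by (intro card_subset_eq) (auto simp: young_diagramD(1) card_mono le_antisym)
        then show False using D by simp
      qed
    qed
  qed (use fin F in auto)
  ultimately show False using F(1) young by (simp add: frob_coeff_same)
qed

lemma schur_expansion_unique:
  assumes "schur_expansion a b D c" "schur_expansion a b D c'"
  shows "c = c'"
proof
  fix E
  let ?S = "{E. c E \<noteq> 0} \<union> {E. c' E \<noteq> 0}"
  have fin: "finite ?S" and young: "\<And>E. E \<in> ?S \<Longrightarrow> young_diagram E"
    using assms unfolding schur_expansion_def by auto
  have "multi_schur a D = (\<Sum>E\<in>?S. scalar (f E) * multi_schur b E)"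
    if "schur_expansion a b D f" "{E. f E \<noteq> 0} \<subseteq> ?S" for f
  proof -
    have "multi_schur a D = (\<Sum>E | f E \<noteq> 0. scalar (f E) * multi_schur b E)"
      using that(1) by (simp add: schur_expansion_def)
    also have "\<dots> = (\<Sum>E\<in>?S. scalar (f E) * multi_schur b E)"
      by (rule sum.mono_neutral_left) (use fin that in auto)
    finally show ?thesis .
  qed
  from this[OF assms(1)] this[OF assms(2)]
  have "(\<Sum>E\<in>?S. scalar (c E - c' E) * multi_schur b E) = 0"
    by (simp add: scalar.hom_minus left_diff_distrib sum_subtractf)
  then have "E \<in> ?S \<Longrightarrow> c E - c' E = 0"
    using multi_schur_independent[OF fin young, of "\<lambda>E. c E - c' E" b E] by blast
  then show "c E = c' E" by (cases "E \<in> ?S") simp_all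
qed

lemma transition_coeff_eq_frob_coeff:
  "young_diagram D \<Longrightarrow> transition_coeff a b D = frob_coeff a b D"
  unfolding transition_coeff_def
  using schur_expansion_frob_coeff schur_expansion_unique by (intro the_equality) blast+

theorem theorem7p3:
  fixes a b :: "int \<Rightarrow> complex" and \<mu> :: "(nat \<times> nat) set"
  assumes "young_diagram \<mu>"
  shows "schur_expansion a b \<mu> (transition_coeff a b \<mu>) \<and>
    (\<forall>\<nu>. young_diagram \<nu> \<longrightarrow> \<not> (\<nu> \<subseteq> \<mu> \<and> diag_size \<nu> = diag_size \<mu>) \<longrightarrow>
       transition_coeff a b \<mu> \<nu> = 0) \<and>
    (\<forall>\<nu> d. young_diagram \<nu> \<longrightarrow> diag_size \<nu> = d \<longrightarrow> diag_size \<mu> = d \<longrightarrow>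
       transition_coeff a b \<mu> \<nu> =
         det (mat d d (\<lambda>(i, j). hook_coeff a b
                (frob_p \<mu> (Suc i)) (frob_p \<nu> (Suc j)))) *
         det (mat d d (\<lambda>(i, j). hook_coeff (hat a) (hat b)
                (frob_q \<mu> (Suc i)) (frob_q \<nu> (Suc j)))))"
  unfolding transition_coeff_eq_frob_coeff[OF assms]
proof (intro conjI allI impI)
  show "schur_expansion a b \<mu> (frob_coeff a b \<mu>)"
    by (rule schur_expansion_frob_coeff[OF assms])
next
  fix \<nu> assume "\<not> (\<nu> \<subseteq> \<mu> \<and> diag_size \<nu> = diag_size \<mu>)"
  then show "frob_coeff a b \<mu> \<nu> = 0"
    using frob_coeff_nonzeroD[OF assms] by blast
next
  fix \<nu> d assume \<nu>: "young_diagram \<nu>" "diag_size \<nu> = d" and d: "diag_size \<mu> = d"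
  have "frob_det a b (arms \<mu>) (arms \<nu>) =
      det (mat d d (\<lambda>(i, j). hook_coeff a b (frob_p \<mu> (Suc i)) (frob_p \<nu> (Suc j))))"
    unfolding frob_det_def card_arms[OF assms] d
    by (intro arg_cong[where f = det] eq_matI) (simp_all add: desc_arms assms \<nu> d)
  moreover have "frob_det (hat a) (hat b) (legs \<mu>) (legs \<nu>) =
      det (mat d d (\<lambda>(i, j). hook_coeff (hat a) (hat b) (frob_q \<mu> (Suc i)) (frob_q \<nu> (Suc j))))"
    unfolding frob_det_def card_legs[OF assms] d
    by (intro arg_cong[where f = det] eq_matI) (simp_all add: desc_legs assms \<nu> d)
  ultimately show "frob_coeff a b \<mu> \<nu> =
         det (mat d d (\<lambda>(i, j). hook_coeff a b (frob_p \<mu> (Suc i)) (frob_p \<nu> (Suc j)))) *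
         det (mat d d (\<lambda>(i, j). hook_coeff (hat a) (hat b) (frob_q \<mu> (Suc i)) (frob_q \<nu> (Suc j))))"
    using \<nu> d by (simp add: frob_coeff_def)
qed

end
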